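(* $\mathsf{I}\Sigma_1$ does not prove that for every $m\in\mathbb N$, $\mathrm G^{\mathcal M}_\infty(m)$ is finite. That is, $\mathsf{I}\Sigma_1$ does not prove the (natural arithmetical formalization of the) statement that for every $m\in\mathbb N$ there is $i\in\mathbb N$ such that $\mathrm G^{\mathcal M}_i(m)=0$.
   Context: $\mathsf{I}\Sigma_1$ is the fragment of Peano arithmetic in which induction is restricted to $\Sigma_1$ formulas. For $k\ge2$, $\mathbb M_k$ is the set of base $k$ terms of the multiplicative notation system $\mathcal M$: the least set containing the constants $0$ and $1$ and closed under $\sigma,\tau\mapsto\sigma+\tau$ and $\tau\mapsto k\cdot\tau$ (multiplication by the base $k$ is a unary operation). Terms are identified modulo associativity of $+$. The value $|\tau|\in\mathbb N$ is the natural number obtained by evaluating the term. For $q\in\mathbb N$, $\bar 0=0$ and for $q>0$, $\bar q=1+\cdots+1$ ($q$ times). Normal forms: given $m\in\mathbb N$, let $p,q$ be the unique natural numbers with $q<k$ and $m=k\cdot p+q$. If $p=0$, set $\mathrm{nf}_k(m)=\bar q$; if $p>0$ set, inductively, $\mathrm{nf}_k(m)=k\cdot\mathrm{nf}_k(p)+\bar q$, where the summand $\bar q$ is omitted if $q=0$. For $k\le\ell$ and $m\in\mathbb N$, $\uparrow^\ell_km$ is the value of the term obtained from $\mathrm{nf}_k(m)$ by replacing every operation $k\cdot(\,)$ by $\ell\cdot(\,)$. The $\mathcal M$-Goodstein sequence beginning at $m$ (with initial base $2$) is $\mathrm G^{\mathcal M}_0(m)=m$ and $\mathrm G^{\mathcal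 M}_{i+1}(m)=\uparrow^{i+3}_{i+2}\mathrm G^{\mathcal M}_i(m)-1$ if $\mathrm G^{\mathcal M}_i(m)>0$; the sequence stops once it reaches $0$. $\mathrm G^{\mathcal M}_\infty(m)$ is the least $\ell$ with $\mathrm G^{\mathcal M}_\ell(m)=0$, and $\infty$ if there is none. *)

theory Defs
  imports "HOL-Number_Theory.Cong" "HOL-Library.Nat_Bijection"
begin

section \<open>Multiplicative Goodstein sequences\<close>

text \<open>
  The base is not recorded in a term: for every \<open>k\<close> the base \<open>k\<close> terms are the elements of
  \<open>mterm\<close>, with \<open>Times t\<close> read as \<open>k \<cdot> t\<close>. Thus replacing \<open>k \<cdot> ( )\<close> by \<open>\<ell> \<cdot> ( )\<close> amounts to
  evaluating the same element of \<open>mterm\<close> with \<open>\<ell>\<close> in place of \<open>k\<close>. Values do not depend on the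
  bracketing of sums; \<open>1 + \<dots> + 1\<close> is bracketed to the left.
\<close>

datatype mterm = MZero | MOne | Plus mterm mterm | Times mterm

primrec mval :: "nat \<Rightarrow> mterm \<Rightarrow> nat" where
  "mval k MZero = 0"
| "mval k MOne = 1"
| "mval k (Plus s t) = mval k s + mval k t"
| "mval k (Times t) = k * mval k t"

fun mnum :: "nat \<Rightarrow> mterm" where
  "mnum 0 = MZero"
| "mnum (Suc 0) = MOne"
| "mnum (Suc (Suc q)) = Plus (mnum (Suc q)) MOne"

text \<open>Normal forms only make sense for \<open>k \<ge> 2\<close>; the first branch makes the function total.\<close>

function nf :: "nat \<Rightarrow> nat \<Rightarrow> mterm" where
  "nf k m =
    (if k < 2 then MZero
     else let p = m div k; q = m mod k in
       if p = 0 then mnum q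
       else if q = 0 then Times (nf k p)
       else Plus (Times (nf k p)) (mnum q))"
  by pat_completeness auto
termination
  by (relation "measure snd") (auto simp: div_eq_0_iff intro!: div_less_dividend gr0I)

declare nf.simps [simp del]

definition upgrade :: "nat \<Rightarrow> nat \<Rightarrow> nat \<Rightarrow> nat" where
  "upgrade k l m = mval l (nf k m)"

text \<open>The sequence stops at 0; beyond that point it is continued by 0.\<close>

primrec goodstein :: "nat \<Rightarrow> nat \<Rightarrow> nat" where
  "goodstein m 0 = m"
| "goodstein m (Suc i) =
    (if goodstein m i = 0 then 0 else upgrade (i + 2) (i + 3) (goodstein m i) - 1)"


section \<open>First-order arithmetic\<close>

text \<open>Terms and formulas use de Bruijn indices: \<open>Var 0\<close> refers to the innermost quantifier.\<close>

datatype tm = Var nat | Zero | Succ tm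
  | Add tm tm (infixl "\<^bold>+" 65) | Mul tm tm (infixl "\<^bold>*" 70)

datatype fm = Fls | Eq tm tm (infix "\<^bold>=" 50) | Le tm tm (infix "\<^bold>\<le>" 50)
  | Imp fm fm (infixr "\<^bold>\<longrightarrow>" 25) | And fm fm (infixr "\<^bold>\<and>" 35) | Or fm fm (infixr "\<^bold>\<or>" 30)
  | All fm ("\<^bold>\<forall> _" [40] 40) | Ex fm ("\<^bold>\<exists> _" [40] 40)

abbreviation Neg :: "fm \<Rightarrow> fm" ("\<^bold>\<not> _" [40] 40) where
  "\<^bold>\<not> \<phi> \<equiv> \<phi> \<^bold>\<longrightarrow> Fls"

abbreviation Iff :: "fm \<Rightarrow> fm \<Rightarrow> fm" (infixr "\<^bold>\<longleftrightarrow>" 25) where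
  "\<phi> \<^bold>\<longleftrightarrow> \<psi> \<equiv> (\<phi> \<^bold>\<longrightarrow> \<psi>) \<^bold>\<and> (\<psi> \<^bold>\<longrightarrow> \<phi>)"

abbreviation Less :: "tm \<Rightarrow> tm \<Rightarrow> fm" (infix "\<^bold><" 50) where
  "s \<^bold>< t \<equiv> Succ s \<^bold>\<le> t"

primrec subst_tm :: "(nat \<Rightarrow> tm) \<Rightarrow> tm \<Rightarrow> tm" where
  "subst_tm \<sigma> (Var n) = \<sigma> n"
| "subst_tm \<sigma> Zero = Zero"
| "subst_tm \<sigma> (Succ t) = Succ (subst_tm \<sigma> t)"
| "subst_tm \<sigma> (s \<^bold>+ t) = subst_tm \<sigma> s \<^bold>+ subst_tm \<sigma> t"
| "subst_tm \<sigma> (s \<^bold>* t) = subst_tm \<sigma> s \<^bold>* subst_tm \<sigma> t"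

text \<open>\<open>lift n t\<close> is \<open>t\<close> placed under \<open>n\<close> additional quantifiers.\<close>

definition lift :: "nat \<Rightarrow> tm \<Rightarrow> tm" where
  "lift n = subst_tm (\<lambda>i. Var (i + n))"

definition under :: "(nat \<Rightarrow> tm) \<Rightarrow> nat \<Rightarrow> tm" where
  "under \<sigma> = case_nat (Var 0) (\<lambda>n. lift 1 (\<sigma> n))"

primrec subst :: "(nat \<Rightarrow> tm) \<Rightarrow> fm \<Rightarrow> fm" where
  "subst \<sigma> Fls = Fls"
| "subst \<sigma> (s \<^bold>= t) = (subst_tm \<sigma> s \<^bold>= subst_tm \<sigma> t)"
| "subst \<sigma> (s \<^bold>\<le> t) = (subst_tm \<sigma> s \<^bold>\<le> subst_tm \<sigma> t)"
| "subst \<sigma> (\<phi> \<^bold>\<longrightarrow> \<psi>) = (subst \<sigma> \<phi> \<^bold>\<longrightarrow> subst \<sigma> \<psi>)"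
| "subst \<sigma> (\<phi> \<^bold>\<and> \<psi>) = (subst \<sigma> \<phi> \<^bold>\<and> subst \<sigma> \<psi>)"
| "subst \<sigma> (\<phi> \<^bold>\<or> \<psi>) = (subst \<sigma> \<phi> \<^bold>\<or> subst \<sigma> \<psi>)"
| "subst \<sigma> (\<^bold>\<forall> \<phi>) = (\<^bold>\<forall> subst (under \<sigma>) \<phi>)"
| "subst \<sigma> (\<^bold>\<exists> \<phi>) = (\<^bold>\<exists> subst (under \<sigma>) \<phi>)"

text \<open>\<open>inst t \<phi>\<close> is the body \<open>\<phi>\<close> of a quantifier with the bound variable replaced by \<open>t\<close>;
  \<open>lift_fm \<phi>\<close> is \<open>\<phi>\<close> placed under one additional quantifier.\<close>

definition inst :: "tm \<Rightarrow> fm \<Rightarrow> fm" where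
  "inst t = subst (case_nat t Var)"

definition lift_fm :: "fm \<Rightarrow> fm" where
  "lift_fm = subst (\<lambda>i. Var (Suc i))"

primrec below_tm :: "nat \<Rightarrow> tm \<Rightarrow> bool" where
  "below_tm n (Var i) \<longleftrightarrow> i < n"
| "below_tm n Zero \<longleftrightarrow> True"
| "below_tm n (Succ t) \<longleftrightarrow> below_tm n t"
| "below_tm n (s \<^bold>+ t) \<longleftrightarrow> below_tm n s \<and> below_tm n t"
| "below_tm n (s \<^bold>* t) \<longleftrightarrow> below_tm n s \<and> below_tm n t"

primrec below :: "nat \<Rightarrow> fm \<Rightarrow> bool" where
  "below n Fls \<longleftrightarrow> True"
| "below n (s \<^bold>= t) \<longleftrightarrow> below_tm n s \<and> below_tm n t"
| "below n (s \<^bold>\<le> t) \<longleftrightarrow> below_tm n s \<and> below_tm n t"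
| "below n (\<phi> \<^bold>\<longrightarrow> \<psi>) \<longleftrightarrow> below n \<phi> \<and> below n \<psi>"
| "below n (\<phi> \<^bold>\<and> \<psi>) \<longleftrightarrow> below n \<phi> \<and> below n \<psi>"
| "below n (\<phi> \<^bold>\<or> \<psi>) \<longleftrightarrow> below n \<phi> \<and> below n \<psi>"
| "below n (\<^bold>\<forall> \<phi>) \<longleftrightarrow> below (Suc n) \<phi>"
| "below n (\<^bold>\<exists> \<phi>) \<longleftrightarrow> below (Suc n) \<phi>"

definition sentence :: "fm \<Rightarrow> bool" where
  "sentence = below 0"

text \<open>Natural deduction for classical first-order logic with equality.\<close>

inductive deriv :: "fm set \<Rightarrow> fm \<Rightarrow> bool" (infix "\<turnstile>" 20) where
  Assm: "\<phi> \<in> \<Gamma> \<Longrightarrow> \<Gamma> \<turnstile> \<phi>"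
| Contr: "insert (\<^bold>\<not> \<phi>) \<Gamma> \<turnstile> Fls \<Longrightarrow> \<Gamma> \<turnstile> \<phi>"
| ImpI: "insert \<phi> \<Gamma> \<turnstile> \<psi> \<Longrightarrow> \<Gamma> \<turnstile> \<phi> \<^bold>\<longrightarrow> \<psi>"
| ImpE: "\<lbrakk>\<Gamma> \<turnstile> \<phi> \<^bold>\<longrightarrow> \<psi>; \<Gamma> \<turnstile> \<phi>\<rbrakk> \<Longrightarrow> \<Gamma> \<turnstile> \<psi>"
| AndI: "\<lbrakk>\<Gamma> \<turnstile> \<phi>; \<Gamma> \<turnstile> \<psi>\<rbrakk> \<Longrightarrow> \<Gamma> \<turnstile> \<phi> \<^bold>\<and> \<psi>"
| AndE1: "\<Gamma> \<turnstile> \<phi> \<^bold>\<and> \<psi> \<Longrightarrow> \<Gamma> \<turnstile> \<phi>"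
| AndE2: "\<Gamma> \<turnstile> \<phi> \<^bold>\<and> \<psi> \<Longrightarrow> \<Gamma> \<turnstile> \<psi>"
| OrI1: "\<Gamma> \<turnstile> \<phi> \<Longrightarrow> \<Gamma> \<turnstile> \<phi> \<^bold>\<or> \<psi>"
| OrI2: "\<Gamma> \<turnstile> \<psi> \<Longrightarrow> \<Gamma> \<turnstile> \<phi> \<^bold>\<or> \<psi>"
| OrE: "\<lbrakk>\<Gamma> \<turnstile> \<phi> \<^bold>\<or> \<psi>; insert \<phi> \<Gamma> \<turnstile> \<chi>; insert \<psi> \<Gamma> \<turnstile> \<chi>\<rbrakk> \<Longrightarrow> \<Gamma> \<turnstile> \<chi>"
| AllI: "lift_fm ` \<Gamma> \<turnstile> \<phi> \<Longrightarrow> \<Gamma> \<turnstile> \<^bold>\<forall> \<phi>"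
| AllE: "\<Gamma> \<turnstile> \<^bold>\<forall> \<phi> \<Longrightarrow> \<Gamma> \<turnstile> inst t \<phi>"
| ExI: "\<Gamma> \<turnstile> inst t \<phi> \<Longrightarrow> \<Gamma> \<turnstile> \<^bold>\<exists> \<phi>"
| ExE: "\<lbrakk>\<Gamma> \<turnstile> \<^bold>\<exists> \<phi>; insert \<phi> (lift_fm ` \<Gamma>) \<turnstile> lift_fm \<psi>\<rbrakk> \<Longrightarrow> \<Gamma> \<turnstile> \<psi>"
| Refl: "\<Gamma> \<turnstile> t \<^bold>= t"
| Replace: "\<lbrakk>\<Gamma> \<turnstile> s \<^bold>= t; \<Gamma> \<turnstile> inst s \<phi>\<rbrakk> \<Longrightarrow> \<Gamma> \<turnstile> inst t \<phi>"

text \<open>Bounded quantifiers; the bounding term is outside the scope of the quantified variable.\<close>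

definition ball :: "tm \<Rightarrow> fm \<Rightarrow> fm" ("\<^bold>\<forall>\<^bold>\<le> _. _" [51, 40] 40) where
  "(\<^bold>\<forall>\<^bold>\<le> t. \<phi>) = (\<^bold>\<forall> (Var 0 \<^bold>\<le> lift 1 t \<^bold>\<longrightarrow> \<phi>))"

definition bex :: "tm \<Rightarrow> fm \<Rightarrow> fm" ("\<^bold>\<exists>\<^bold>\<le> _. _" [51, 40] 40) where
  "(\<^bold>\<exists>\<^bold>\<le> t. \<phi>) = (\<^bold>\<exists> (Var 0 \<^bold>\<le> lift 1 t \<^bold>\<and> \<phi>))"

inductive delta0 :: "fm \<Rightarrow> bool" where
  "delta0 Fls"
| "delta0 (s \<^bold>= t)"
| "delta0 (s \<^bold>\<le> t)"
| "\<lbrakk>delta0 \<phi>; delta0 \<psi>\<rbrakk> \<Longrightarrow> delta0 (\<phi> \<^bold>\<longrightarrow> \<psi>)"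
| "\<lbrakk>delta0 \<phi>; delta0 \<psi>\<rbrakk> \<Longrightarrow> delta0 (\<phi> \<^bold>\<and> \<psi>)"
| "\<lbrakk>delta0 \<phi>; delta0 \<psi>\<rbrakk> \<Longrightarrow> delta0 (\<phi> \<^bold>\<or> \<psi>)"
| "delta0 \<phi> \<Longrightarrow> delta0 (\<^bold>\<forall>\<^bold>\<le> t. \<phi>)"
| "delta0 \<phi> \<Longrightarrow> delta0 (\<^bold>\<exists>\<^bold>\<le> t. \<phi>)"

inductive sigma1 :: "fm \<Rightarrow> bool" where
  "delta0 \<phi> \<Longrightarrow> sigma1 \<phi>"
| "sigma1 \<phi> \<Longrightarrow> sigma1 (\<^bold>\<exists> \<phi>)"

definition robinson :: "fm set" where
  "robinson =
   {\<^bold>\<forall> \<^bold>\<not> (Succ (Var 0) \<^bold>= Zero),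
    \<^bold>\<forall> \<^bold>\<forall> (Succ (Var 1) \<^bold>= Succ (Var 0) \<^bold>\<longrightarrow> Var 1 \<^bold>= Var 0),
    \<^bold>\<forall> (\<^bold>\<not> (Var 0 \<^bold>= Zero) \<^bold>\<longrightarrow> (\<^bold>\<exists> (Var 1 \<^bold>= Succ (Var 0)))),
    \<^bold>\<forall> (Var 0 \<^bold>+ Zero \<^bold>= Var 0),
    \<^bold>\<forall> \<^bold>\<forall> (Var 1 \<^bold>+ Succ (Var 0) \<^bold>= Succ (Var 1 \<^bold>+ Var 0)),
    \<^bold>\<forall> (Var 0 \<^bold>* Zero \<^bold>= Zero),
    \<^bold>\<forall> \<^bold>\<forall> (Var 1 \<^bold>* Succ (Var 0) \<^bold>= Var 1 \<^bold>* Var 0 \<^bold>+ Var 1),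
    \<^bold>\<forall> \<^bold>\<forall> (Var 1 \<^bold>\<le> Var 0 \<^bold>\<longleftrightarrow> (\<^bold>\<exists> (Var 0 \<^bold>+ Var 2 \<^bold>= Var 1)))}"

text \<open>Induction on the variable 0 of \<open>\<phi>\<close>; its other variables are parameters. The substitution in
  the induction step replaces \<open>Var 0\<close> by its successor and leaves the parameters untouched.\<close>

definition induction_fm :: "fm \<Rightarrow> fm" where
  "induction_fm \<phi> =
    (inst Zero \<phi> \<^bold>\<and> (\<^bold>\<forall> (\<phi> \<^bold>\<longrightarrow> subst (Var(0 := Succ (Var 0))) \<phi>)) \<^bold>\<longrightarrow> (\<^bold>\<forall> \<phi>))"

text \<open>The axioms are sentences: an instance of induction is closed by prefixing universal
  quantifiers over its parameters.\<close>

definition ISigma1 :: "fm set" where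
  "ISigma1 = robinson \<union>
    {(All ^^ n) (induction_fm \<phi>) | n \<phi>. sigma1 \<phi> \<and> sentence ((All ^^ n) (induction_fm \<phi>))}"


section \<open>Arithmetization of multiplicative Goodstein sequences\<close>

text \<open>
  Finite sequences are coded by Goedel's \<open>\<beta>\<close> function, pairs by Cantor's pairing function, and
  multiplicative terms by the numbers \<open>mcode t\<close> below. The arguments of the following formulas are
  terms, hence are lifted inside quantifiers.
\<close>

definition beta :: "nat \<Rightarrow> nat \<Rightarrow> nat \<Rightarrow> nat" where
  "beta c d i = c mod Suc (Suc i * d)"

primrec mcode :: "mterm \<Rightarrow> nat" where
  "mcode MZero = prod_encode (0, 0)"
| "mcode MOne = prod_encode (0, 1)"
| "mcode (Plus s t) = prod_encode (1, prod_encode (mcode s, mcode t))"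
| "mcode (Times t) = prod_encode (2, mcode t)"

text \<open>\<open>beta c d i = v\<close>\<close>

definition beta_fm :: "tm \<Rightarrow> tm \<Rightarrow> tm \<Rightarrow> tm \<Rightarrow> fm" where
  "beta_fm c d i v =
    (v \<^bold>< Succ (Succ i \<^bold>* d) \<^bold>\<and>
     (\<^bold>\<exists>\<^bold>\<le> c. lift 1 c \<^bold>= Var 0 \<^bold>* lift 1 (Succ (Succ i \<^bold>* d)) \<^bold>+ lift 1 v))"

text \<open>\<open>prod_encode (a, b) = x\<close>, that is \<open>2 x = (a + b) (a + b + 1) + 2 a\<close>\<close>

definition pair_fm :: "tm \<Rightarrow> tm \<Rightarrow> tm \<Rightarrow> fm" where
  "pair_fm a b x = (x \<^bold>+ x \<^bold>= (a \<^bold>+ b) \<^bold>* Succ (a \<^bold>+ b) \<^bold>+ (a \<^bold>+ a))"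

definition mzero_fm :: "tm \<Rightarrow> fm" where
  "mzero_fm x = pair_fm Zero Zero x"

definition mone_fm :: "tm \<Rightarrow> fm" where
  "mone_fm x = pair_fm Zero (Succ Zero) x"

definition plus_fm :: "tm \<Rightarrow> tm \<Rightarrow> tm \<Rightarrow> fm" where
  "plus_fm a b x =
    (\<^bold>\<exists>\<^bold>\<le> x. (pair_fm (lift 1 a) (lift 1 b) (Var 0) \<^bold>\<and> pair_fm (Succ Zero) (Var 0) (lift 1 x)))"

definition times_fm :: "tm \<Rightarrow> tm \<Rightarrow> fm" where
  "times_fm a x = pair_fm (Succ (Succ Zero)) a x"

text \<open>\<open>mcode (mnum q) = x\<close>: either \<open>q = 0\<close>, or there is a sequence (coded by \<open>Var 1\<close>, \<open>Var 0\<close>)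
  whose entries with indices \<open>0, \<dots>, q - 1\<close> are the codes of \<open>mnum 1, \<dots>, mnum q\<close>.\<close>

definition mnum_fm :: "tm \<Rightarrow> tm \<Rightarrow> fm" where
  "mnum_fm q x =
    (q \<^bold>= Zero \<^bold>\<and> mzero_fm x \<^bold>\<or>
     (\<^bold>\<exists> \<^bold>\<exists>
       ((\<^bold>\<exists> (beta_fm (Var 2) (Var 1) Zero (Var 0) \<^bold>\<and> mone_fm (Var 0))) \<^bold>\<and>
        (\<^bold>\<forall>\<^bold>\<le> lift 2 q. (Succ (Var 0) \<^bold>< lift 3 q \<^bold>\<longrightarrow>
          (\<^bold>\<exists> \<^bold>\<exists> \<^bold>\<exists>
            (beta_fm (Var 5) (Var 4) (Var 3) (Var 2) \<^bold>\<and>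
             beta_fm (Var 5) (Var 4) (Succ (Var 3)) (Var 1) \<^bold>\<and>
             mone_fm (Var 0) \<^bold>\<and> plus_fm (Var 2) (Var 0) (Var 1))))) \<^bold>\<and>
        (\<^bold>\<exists> (lift 3 q \<^bold>= Succ (Var 0) \<^bold>\<and> beta_fm (Var 2) (Var 1) (Var 0) (lift 3 x))))))"

text \<open>\<open>mcode (nf k m) = y\<close>: there is a sequence whose entry with index \<open>x\<close> is the code of \<open>nf k x\<close>,
  for all \<open>x \<le> m\<close>. In the scope of the quantifiers following \<open>x\<close>, the variables 3, 2, 1, 0 are
  \<open>x\<close>, \<open>p\<close>, \<open>q\<close> and the code of \<open>nf k x\<close>.\<close>

definition nf_fm :: "tm \<Rightarrow> tm \<Rightarrow> tm \<Rightarrow> fm" where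
  "nf_fm k m y =
    (\<^bold>\<exists> \<^bold>\<exists>
      ((\<^bold>\<forall>\<^bold>\<le> lift 2 m.
         (\<^bold>\<exists> \<^bold>\<exists> \<^bold>\<exists>
           (Var 1 \<^bold>< lift 6 k \<^bold>\<and> Var 3 \<^bold>= lift 6 k \<^bold>* Var 2 \<^bold>+ Var 1 \<^bold>\<and>
            beta_fm (Var 5) (Var 4) (Var 3) (Var 0) \<^bold>\<and>
            (Var 2 \<^bold>= Zero \<^bold>\<and> mnum_fm (Var 1) (Var 0) \<^bold>\<or>
             Zero \<^bold>< Var 2 \<^bold>\<and>
             (\<^bold>\<exists> \<^bold>\<exists>
               (beta_fm (Var 7) (Var 6) (Var 4) (Var 1) \<^bold>\<and> times_fm (Var 1) (Var 0) \<^bold>\<and>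
                (Var 3 \<^bold>= Zero \<^bold>\<and> Var 2 \<^bold>= Var 0 \<^bold>\<or>
                 Zero \<^bold>< Var 3 \<^bold>\<and>
                 (\<^bold>\<exists> (mnum_fm (Var 4) (Var 0) \<^bold>\<and> plus_fm (Var 1) (Var 0) (Var 3)))))))))) \<^bold>\<and>
       beta_fm (Var 1) (Var 0) (lift 2 m) (lift 2 y)))"

text \<open>\<open>mval l t = v\<close> for the term \<open>t\<close> with code \<open>y\<close>: there is a sequence whose entry with
  index \<open>mcode s\<close> is \<open>mval l s\<close>, for all terms \<open>s\<close> with \<open>mcode s \<le> y\<close>.\<close>

definition mval_fm :: "tm \<Rightarrow> tm \<Rightarrow> tm \<Rightarrow> fm" where
  "mval_fm l y v =
    (\<^bold>\<exists> \<^bold>\<exists>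
      ((\<^bold>\<forall>\<^bold>\<le> lift 2 y.
         (\<^bold>\<exists>
           (beta_fm (Var 3) (Var 2) (Var 1) (Var 0) \<^bold>\<and>
            (mzero_fm (Var 1) \<^bold>\<longrightarrow> Var 0 \<^bold>= Zero) \<^bold>\<and>
            (mone_fm (Var 1) \<^bold>\<longrightarrow> Var 0 \<^bold>= Succ Zero) \<^bold>\<and>
            (\<^bold>\<forall>\<^bold>\<le> Var 1. (\<^bold>\<forall>\<^bold>\<le> Var 2. (plus_fm (Var 1) (Var 0) (Var 3) \<^bold>\<longrightarrow>
              (\<^bold>\<exists> \<^bold>\<exists>
                (beta_fm (Var 7) (Var 6) (Var 3) (Var 1) \<^bold>\<and>
                 beta_fm (Var 7) (Var 6) (Var 2) (Var 0) \<^bold>\<and>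
                 Var 4 \<^bold>= Var 1 \<^bold>+ Var 0))))) \<^bold>\<and>
            (\<^bold>\<forall>\<^bold>\<le> Var 1. (times_fm (Var 0) (Var 2) \<^bold>\<longrightarrow>
              (\<^bold>\<exists>
                (beta_fm (Var 5) (Var 4) (Var 1) (Var 0) \<^bold>\<and>
                 Var 2 \<^bold>= lift 6 l \<^bold>* Var 0))))))) \<^bold>\<and>
       beta_fm (Var 1) (Var 0) (lift 2 y) (lift 2 v)))"

text \<open>\<open>upgrade k l m = v\<close>\<close>

definition upgrade_fm :: "tm \<Rightarrow> tm \<Rightarrow> tm \<Rightarrow> tm \<Rightarrow> fm" where
  "upgrade_fm k l m v =
    (\<^bold>\<exists> (nf_fm (lift 1 k) (lift 1 m) (Var 0) \<^bold>\<and> mval_fm (lift 1 l) (Var 0) (lift 1 v)))"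

text \<open>The Goodstein sequence beginning at \<open>m\<close> does not stop before step \<open>i\<close>, and its entry with
  index \<open>i\<close> is \<open>v\<close>.\<close>

definition goodstein_fm :: "tm \<Rightarrow> tm \<Rightarrow> tm \<Rightarrow> fm" where
  "goodstein_fm m i v =
    (\<^bold>\<exists> \<^bold>\<exists>
      (beta_fm (Var 1) (Var 0) Zero (lift 2 m) \<^bold>\<and>
       (\<^bold>\<forall>\<^bold>\<le> lift 2 i. (Var 0 \<^bold>< lift 3 i \<^bold>\<longrightarrow>
         (\<^bold>\<exists> \<^bold>\<exists>
           (beta_fm (Var 4) (Var 3) (Var 2) (Var 1) \<^bold>\<and>
            beta_fm (Var 4) (Var 3) (Succ (Var 2)) (Var 0) \<^bold>\<and>
            Zero \<^bold>< Var 1 \<^bold>\<and>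
            upgrade_fm (Succ (Succ (Var 2))) (Succ (Succ (Succ (Var 2)))) (Var 1)
              (Succ (Var 0)))))) \<^bold>\<and>
       beta_fm (Var 1) (Var 0) (lift 2 i) (lift 2 v)))"

text \<open>For every \<open>m\<close> there is \<open>i\<close> such that the Goodstein sequence beginning at \<open>m\<close> is 0 at \<open>i\<close>.\<close>

definition goodstein_terminates :: fm where
  "goodstein_terminates = (\<^bold>\<forall> \<^bold>\<exists> goodstein_fm (Var 1) (Var 0) Zero)"


section \<open>Adequacy of the arithmetization\<close>

text \<open>In the standard model, \<open>goodstein_terminates\<close> says that all multiplicative Goodstein
  sequences reach 0.\<close>

primrec tm_val :: "(nat \<Rightarrow> nat) \<Rightarrow> tm \<Rightarrow> nat" where
  "tm_val e (Var n) = e n"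
| "tm_val e Zero = 0"
| "tm_val e (Succ t) = Suc (tm_val e t)"
| "tm_val e (s \<^bold>+ t) = tm_val e s + tm_val e t"
| "tm_val e (s \<^bold>* t) = tm_val e s * tm_val e t"

primrec holds :: "(nat \<Rightarrow> nat) \<Rightarrow> fm \<Rightarrow> bool" where
  "holds e Fls \<longleftrightarrow> False"
| "holds e (s \<^bold>= t) \<longleftrightarrow> tm_val e s = tm_val e t"
| "holds e (s \<^bold>\<le> t) \<longleftrightarrow> tm_val e s \<le> tm_val e t"
| "holds e (\<phi> \<^bold>\<longrightarrow> \<psi>) \<longleftrightarrow> (holds e \<phi> \<longrightarrow> holds e \<psi>)"
| "holds e (\<phi> \<^bold>\<and> \<psi>) \<longleftrightarrow> holds e \<phi> \<and> holds e \<psi>"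
| "holds e (\<phi> \<^bold>\<or> \<psi>) \<longleftrightarrow> holds e \<phi> \<or> holds e \<psi>"
| "holds e (\<^bold>\<forall> \<phi>) \<longleftrightarrow> (\<forall>x. holds (case_nat x e) \<phi>)"
| "holds e (\<^bold>\<exists> \<phi>) \<longleftrightarrow> (\<exists>x. holds (case_nat x e) \<phi>)"

lemma tm_val_subst: "tm_val e (subst_tm \<sigma> t) = tm_val (\<lambda>n. tm_val e (\<sigma> n)) t"
  by (induction t) auto

lemma tm_val_lift: "tm_val e (lift n t) = tm_val (\<lambda>i. e (i + n)) t"
  by (simp add: lift_def tm_val_subst)

lemma tm_val_lift_simps [simp]:
  "tm_val e (lift 0 t) = tm_val e t"
  "tm_val (case_nat x e) (lift (Suc n) t) = tm_val e (lift n t)"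
  "tm_val (case_nat x e) (lift 1 t) = tm_val e t"
  "tm_val (case_nat x e) (lift (numeral k) t) = tm_val e (lift (pred_numeral k) t)"
  by (simp_all add: tm_val_lift numeral_eq_Suc)

lemma holds_ball [simp]:
  "holds e (\<^bold>\<forall>\<^bold>\<le> t. \<phi>) \<longleftrightarrow> (\<forall>x\<le>tm_val e t. holds (case_nat x e) \<phi>)"
  by (simp add: ball_def)

lemma holds_bex [simp]:
  "holds e (\<^bold>\<exists>\<^bold>\<le> t. \<phi>) \<longleftrightarrow> (\<exists>x\<le>tm_val e t. holds (case_nat x e) \<phi>)"
  by (simp add: bex_def)

lemma mod_eq_iff: "0 < (n::nat) \<Longrightarrow> c mod n = v \<longleftrightarrow> v < n \<and> (\<exists>x\<le>c. c = x * n + v)"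
proof
  assume "0 < n" "c mod n = v"
  then show "v < n \<and> (\<exists>x\<le>c. c = x * n + v)"
    by (intro conjI exI[of _ "c div n"]) auto
qed auto

lemma holds_beta_fm [simp]:
  "holds e (beta_fm c d i v) \<longleftrightarrow> beta (tm_val e c) (tm_val e d) (tm_val e i) = tm_val e v"
  unfolding beta_fm_def beta_def by (subst mod_eq_iff) (auto simp: less_Suc_eq_le)

lemma holds_pair_fm [simp]:
  "holds e (pair_fm a b x) \<longleftrightarrow> prod_encode (tm_val e a, tm_val e b) = tm_val e x"
proof -
  have "2 * triangle n = n * Suc n" for n
    by (simp add: triangle_def)
  then have "2 * prod_encode (a', b') = (a' + b') * Suc (a' + b') + (a' + a')" for a' b'
    by (simp only: prod_encode_def prod.case distrib_left mult_2)
  from this[of "tm_val e a" "tm_val e b"] show ?thesis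
    unfolding pair_fm_def holds.simps tm_val.simps by (intro iffI) linarith+
qed

lemma holds_code_fms [simp]:
  "holds e (mzero_fm x) \<longleftrightarrow> tm_val e x = prod_encode (0, 0)"
  "holds e (mone_fm x) \<longleftrightarrow> tm_val e x = prod_encode (0, 1)"
  "holds e (plus_fm a b x) \<longleftrightarrow> tm_val e x = prod_encode (1, prod_encode (tm_val e a, tm_val e b))"
  "holds e (times_fm a x) \<longleftrightarrow> tm_val e x = prod_encode (2, tm_val e a)"
  using le_prod_encode_2[of _ 1]
  by (auto simp: mzero_fm_def mone_fm_def plus_fm_def times_fm_def numeral_2_eq_2)

lemma beta_exists: "\<exists>c d. \<forall>i\<le>n. beta c d i = f i"
proof -
  define N where "N = Suc (n + (\<Sum>i\<le>n. f i))"
  define d :: nat where "d = fact N"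
  let ?m = "\<lambda>i. Suc (Suc i * d)"
  have "N \<le> d"
    unfolding d_def by (rule fact_ge_self)
  have cop: "coprime (?m i) (?m j)" if "i < j" "j \<le> n" for i j
  proof (rule ccontr)
    assume "\<not> coprime (?m i) (?m j)"
    then obtain p where p: "prime p" "p dvd ?m i" "p dvd ?m j"
      by (metis coprime_iff_gcd_eq_1 gcd_nat.bounded_iff prime_factor_nat)
    have "?m j - ?m i = (j - i) * d"
      using that by (simp add: algebra_simps)
    then have "p dvd (j - i) * d"
      using p by (metis dvd_diff_nat)
    moreover have "\<not> p dvd d"
    proof
      assume "p dvd d"
      then have "p dvd Suc i * d" by simp
      with p(2) have "p dvd 1"
        using dvd_diff_nat[of p "?m i" "Suc i * d"] by simp
      with p(1) show False by simp
    qed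
    ultimately have "p dvd j - i"
      using p(1) by (simp add: prime_dvd_mult_iff)
    moreover have "j - i dvd d"
      unfolding d_def using that by (intro dvd_fact) (auto simp: N_def)
    ultimately show False
      using \<open>\<not> p dvd d\<close> dvd_trans by blast
  qed
  have "\<forall>i\<in>{..n}. \<forall>j\<in>{..n}. i \<noteq> j \<longrightarrow> coprime (?m i) (?m j)"
    using cop by (metis atMost_iff coprime_commute linorder_neqE_nat)
  then obtain c where c: "\<forall>i\<in>{..n}. [c = f i] (mod ?m i)"
    using chinese_remainder_nat[of "{..n}" ?m f] by auto
  have "beta c d i = f i" if "i \<le> n" for i
  proof -
    have "f i \<le> (\<Sum>i\<le>n. f i)"
      using that by (intro member_le_sum) auto
    then have "f i \<le> d"
      using \<open>N \<le> d\<close> by (simp add: N_def)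
    then have "f i < ?m i"
      by simp
    then show ?thesis
      using c that by (auto simp: beta_def cong_def)
  qed
  then show ?thesis by blast
qed

lemma mnum_Suc: "0 < q \<Longrightarrow> mnum (Suc q) = Plus (mnum q) MOne"
  by (cases q) auto

lemma holds_mnum_fm [simp]:
  "holds e (mnum_fm q x) \<longleftrightarrow> mcode (mnum (tm_val e q)) = tm_val e x"
proof -
  define Q X where "Q = tm_val e q" and "X = tm_val e x"
  let ?R = "\<lambda>c d. beta c d 0 = mcode MOne \<and>
    (\<forall>j\<le>Q. Suc j < Q \<longrightarrow> beta c d (Suc j) = prod_encode (1, prod_encode (beta c d j, mcode MOne))) \<and>
    (\<exists>j. Q = Suc j \<and> beta c d j = X)"
  have "holds e (mnum_fm q x) \<longleftrightarrow> Q = 0 \<and> X = mcode MZero \<or> (\<exists>c d. ?R c d)"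
    unfolding mnum_fm_def Q_def X_def by (simp add: Suc_le_eq eq_commute[of _ "tm_val e x"])
  also have "\<dots> \<longleftrightarrow> mcode (mnum Q) = X"
  proof (cases Q)
    case (Suc n)
    have "beta c d j = mcode (mnum (Suc j))" if "?R c d" "j \<le> n" for c d j
      using that(2)
    proof (induction j)
      case (Suc j)
      then have "beta c d (Suc j) = prod_encode (1, prod_encode (beta c d j, mcode MOne))"
        using that(1) \<open>Q = Suc n\<close> by auto
      with Suc show ?case by simp
    qed (use that(1) in simp)
    moreover obtain c d where "\<forall>j\<le>n. beta c d j = mcode (mnum (Suc j))"
      using beta_exists[of n "\<lambda>j. mcode (mnum (Suc j))"] by blast
    then have "?R c d" if "mcode (mnum Q) = X"
      using that Suc by auto
    ultimately show ?thesis
      using Suc by (metis Suc_inject le_refl nat.distinct(1))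
  qed auto
  finally show ?thesis
    by (simp add: Q_def X_def)
qed

lemma nf_step:
  assumes "k \<ge> 2" "q < k" "x = k * p + q"
  shows "nf k x = (if p = 0 then mnum q else if q = 0 then Times (nf k p)
    else Plus (Times (nf k p)) (mnum q))"
  using assms by (subst nf.simps) (auto simp: Let_def)

lemma holds_nf_fm:
  assumes k: "tm_val e k \<ge> 2"
  shows "holds e (nf_fm k m y) \<longleftrightarrow> mcode (nf (tm_val e k) (tm_val e m)) = tm_val e y"
proof -
  define K M Y where "K = tm_val e k" and "M = tm_val e m" and "Y = tm_val e y"
  let ?S = "\<lambda>s x. \<exists>p q. q < K \<and> x = K * p + q \<and>
     (p = 0 \<and> mcode (mnum q) = s x \<or>
      0 < p \<and> (q = 0 \<and> s x = prod_encode (2, s p) \<or>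
        0 < q \<and> s x = prod_encode (1, prod_encode (prod_encode (2, s p), mcode (mnum q)))))"
  have "holds e (nf_fm k m y) \<longleftrightarrow>
      (\<exists>c d. (\<forall>x\<le>M. ?S (beta c d) x) \<and> beta c d M = Y)"
    unfolding nf_fm_def K_def M_def Y_def by (simp add: Suc_le_eq)
  also have "\<dots> \<longleftrightarrow> mcode (nf K M) = Y"
  proof
    assume "\<exists>c d. (\<forall>x\<le>M. ?S (beta c d) x) \<and> beta c d M = Y"
    then obtain s where s: "\<And>x. x \<le> M \<Longrightarrow> ?S s x" "s M = Y" by blast
    have "s x = mcode (nf K x)" if "x \<le> M" for x
      using that
    proof (induction x rule: less_induct)
      case (less x)
      from s(1)[OF less.prems] obtain p q where pq: "q < K" "x = K * p + q"
        and "p = 0 \<and> mcode (mnum q) = s x \<or>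
          0 < p \<and> (q = 0 \<and> s x = prod_encode (2, s p) \<or>
          0 < q \<and> s x = prod_encode (1, prod_encode (prod_encode (2, s p), mcode (mnum q))))"
        by blast
      moreover have "s p = mcode (nf K p)" if "0 < p"
      proof (rule less.IH)
        have "1 * p < K * p"
          using that k by (intro mult_strict_right_mono) (auto simp: K_def)
        then show "p < x" using pq by linarith
        with less.prems show "p \<le> M" by simp
      qed
      ultimately show ?case
        using nf_step[OF k[folded K_def] pq] by auto
    qed
    with s(2) show "mcode (nf K M) = Y" by simp
  next
    assume *: "mcode (nf K M) = Y"
    obtain c d where cd: "\<forall>x\<le>M. beta c d x = mcode (nf K x)"
      using beta_exists[of M "\<lambda>x. mcode (nf K x)"] by blast
    have "?S (beta c d) x" if "x \<le> M" for x
    proof -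
      have pq: "x mod K < K" "x = K * (x div K) + x mod K"
        using k by (simp_all add: K_def)
      have "x div K \<le> M"
        using that div_le_dividend le_trans by blast
      then show ?thesis
        using pq nf_step[OF k[folded K_def] pq] that cd
        by (intro exI[of _ "x div K"] exI[of _ "x mod K"]) auto
    qed
    with * cd show "\<exists>c d. (\<forall>x\<le>M. ?S (beta c d) x) \<and> beta c d M = Y" by blast
  qed
  finally show ?thesis
    by (simp add: K_def M_def Y_def)
qed

lemma triangle_ge: "n \<le> triangle n"
  by (induction n) auto

lemma snd_less_prod_encode: "0 < a \<Longrightarrow> b < prod_encode (a, b)"
  using triangle_ge[of "a + b"] by (simp add: prod_encode_def)

text \<open>The value of the term with code \<open>x\<close>, extended to numbers that are not codes of terms.\<close>

function cval :: "nat \<Rightarrow> nat \<Rightarrow> nat" where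
  "cval l x = (case prod_decode x of (i, j) \<Rightarrow>
     if i = 0 then j
     else if i = 1 then (case prod_decode j of (a, b) \<Rightarrow> cval l a + cval l b)
     else l * cval l j)"
  by pat_completeness auto
termination
proof (relation "measure snd")
  fix l x i j a b :: nat
  assume "(i, j) = prod_decode x" "i \<noteq> 0"
  then have x: "x = prod_encode (i, j)" and "0 < i"
    by (metis prod_decode_inverse, simp)
  then have "j < x"
    using snd_less_prod_encode by simp
  then show "((l, j), l, x) \<in> measure snd"
    by simp
  assume "(a, b) = prod_decode j"
  then have "j = prod_encode (a, b)"
    by (metis prod_decode_inverse)
  with \<open>j < x\<close> show "((l, a), l, x) \<in> measure snd" "((l, b), l, x) \<in> measure snd"
    using le_prod_encode_1[of a b] le_prod_encode_2[of b a] by auto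
qed auto

declare cval.simps [simp del]

lemma holds_mval_fm:
  assumes "tm_val e y = mcode t"
  shows "holds e (mval_fm l y v) \<longleftrightarrow> mval (tm_val e l) t = tm_val e v"
proof -
  define L Y V where "L = tm_val e l" and "Y = mcode t" and "V = tm_val e v"
  let ?S = "\<lambda>s x. (x = mcode MZero \<longrightarrow> s x = 0) \<and> (x = mcode MOne \<longrightarrow> s x = 1) \<and>
    (\<forall>a\<le>x. \<forall>b\<le>x. x = prod_encode (1, prod_encode (a, b)) \<longrightarrow> s x = s a + s b) \<and>
    (\<forall>a\<le>x. x = prod_encode (2, a) \<longrightarrow> s x = L * s a)"
  have "holds e (mval_fm l y v) \<longleftrightarrow>
      (\<exists>c d. (\<forall>x\<le>Y. ?S (beta c d) x) \<and> beta c d Y = V)"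
    unfolding mval_fm_def L_def Y_def V_def using assms by simp
  also have "\<dots> \<longleftrightarrow> mval L t = V"
  proof
    assume "\<exists>c d. (\<forall>x\<le>Y. ?S (beta c d) x) \<and> beta c d Y = V"
    then obtain s where s: "\<And>x. x \<le> Y \<Longrightarrow> ?S s x" "s Y = V" by blast
    have "s (mcode u) = mval L u" if "mcode u \<le> Y" for u
      using that
    proof (induction u)
      case (Plus a b)
      have "mcode a < mcode (Plus a b)" "mcode b < mcode (Plus a b)"
        using le_prod_encode_1[of "mcode a" "mcode b"] le_prod_encode_2[of "mcode b" "mcode a"]
          snd_less_prod_encode[of 1 "prod_encode (mcode a, mcode b)"] by auto
      then show ?case
        using Plus s(1)[OF Plus.prems] by simp
    next
      case (Times a)
      have "mcode a < mcode (Times a)"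
        using snd_less_prod_encode[of 2 "mcode a"] by auto
      then show ?case
        using Times s(1)[OF Times.prems] by simp
    qed (use s(1) in auto)
    with s(2) show "mval L t = V" by (simp add: Y_def)
  next
    assume V: "mval L t = V"
    obtain c d where cd: "\<forall>x\<le>Y. beta c d x = cval L x"
      using beta_exists[of Y "cval L"] by blast
    have "cval L (mcode u) = mval L u" for u
      by (induction u) (subst cval.simps, simp)+
    then have "cval L Y = V"
      using V by (simp add: Y_def)
    moreover have "?S (cval L) x" for x
      by (intro conjI allI impI) (subst cval.simps, simp)+
    ultimately show "\<exists>c d. (\<forall>x\<le>Y. ?S (beta c d) x) \<and> beta c d Y = V"
      using cd by (intro exI[of _ c] exI[of _ d]) auto
  qed
  finally show ?thesis
    by (simp add: L_def V_def)
qed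

lemma holds_upgrade_fm:
  assumes "tm_val e k \<ge> 2"
  shows "holds e (upgrade_fm k l m v) \<longleftrightarrow> upgrade (tm_val e k) (tm_val e l) (tm_val e m) = tm_val e v"
proof -
  let ?t = "nf (tm_val e k) (tm_val e m)"
  have "holds e (upgrade_fm k l m v) \<longleftrightarrow> holds (case_nat (mcode ?t) e) (mval_fm (lift 1 l) (Var 0) (lift 1 v))"
    unfolding upgrade_fm_def using assms by (auto simp: holds_nf_fm)
  also have "\<dots> \<longleftrightarrow> upgrade (tm_val e k) (tm_val e l) (tm_val e m) = tm_val e v"
    by (subst holds_mval_fm[where t = ?t]) (auto simp: upgrade_def)
  finally show ?thesis .
qed

lemma nf_pos: "k \<ge> 2 \<Longrightarrow> l > 0 \<Longrightarrow> m > 0 \<Longrightarrow> mval l (nf k m) > 0"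
proof (induction m rule: less_induct)
  case (less m)
  have num: "mval l (mnum q) = q" for q
    by (induction q rule: mnum.induct) auto
  have "m div k < m"
    using less.prems by simp
  then have "mval l (nf k (m div k)) > 0" if "m div k > 0"
    using less that by blast
  then show ?case
    using less.prems by (subst nf.simps) (auto simp: Let_def num mod_eq_self_iff_div_eq_0[symmetric])
qed

lemma holds_goodstein_fm:
  "holds e (goodstein_fm m i v) \<longleftrightarrow>
    (\<forall>j<tm_val e i. goodstein (tm_val e m) j > 0) \<and> goodstein (tm_val e m) (tm_val e i) = tm_val e v"
proof -
  define M I V where "M = tm_val e m" and "I = tm_val e i" and "V = tm_val e v"
  let ?S = "\<lambda>s. s 0 = M \<and>
    (\<forall>j<I. 0 < s j \<and> upgrade (Suc (Suc j)) (Suc (Suc (Suc j))) (s j) = Suc (s (Suc j))) \<and>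
    s I = V"
  have "holds e (goodstein_fm m i v) \<longleftrightarrow> (\<exists>c d. ?S (beta c d))"
    unfolding goodstein_fm_def M_def I_def V_def
    by (simp add: holds_upgrade_fm Suc_le_eq) (metis less_imp_le_nat)
  also have "\<dots> \<longleftrightarrow> (\<forall>j<I. goodstein M j > 0) \<and> goodstein M I = V"
  proof
    assume "\<exists>c d. ?S (beta c d)"
    then obtain s where s: "?S s" by blast
    have "s j = goodstein M j" if "j \<le> I" for j
      using that
    proof (induction j)
      case (Suc j)
      moreover have "0 < s j \<and> upgrade (j + 2) (j + 3) (s j) = Suc (s (Suc j))"
        using s Suc.prems by (simp add: numeral_eq_Suc)
      ultimately show ?case by simp
    qed (use s in simp)
    with s show "(\<forall>j<I. goodstein M j > 0) \<and> goodstein M I = V" by auto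
  next
    assume *: "(\<forall>j<I. goodstein M j > 0) \<and> goodstein M I = V"
    obtain c d where cd: "\<forall>j\<le>I. beta c d j = goodstein M j"
      using beta_exists[of I "goodstein M"] by blast
    have "upgrade (Suc (Suc j)) (Suc (Suc (Suc j))) (goodstein M j) = Suc (goodstein M (Suc j))"
      if "j < I" for j
      using * that nf_pos[of "j + 2" "j + 3" "goodstein M j"] by (auto simp: upgrade_def numeral_eq_Suc)
    with * cd show "\<exists>c d. ?S (beta c d)"
      by (intro exI[of _ c] exI[of _ d]) auto
  qed
  finally show ?thesis
    by (simp add: M_def I_def V_def)
qed

lemma sentence_goodstein_terminates: "sentence goodstein_terminates"
  by (simp add: sentence_def goodstein_terminates_def goodstein_fm_def upgrade_fm_def nf_fm_def
      mval_fm_def mnum_fm_def mzero_fm_def mone_fm_def plus_fm_def times_fm_def pair_fm_def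
      beta_fm_def ball_def bex_def lift_def)

theorem holds_goodstein_terminates:
  "holds e goodstein_terminates \<longleftrightarrow> (\<forall>m. \<exists>i. goodstein m i = 0)"
proof -
  have "(\<exists>i. (\<forall>j<i. goodstein m j > 0) \<and> goodstein m i = 0) \<longleftrightarrow> (\<exists>i. goodstein m i = 0)" for m
    using exists_least_iff[of "\<lambda>i. goodstein m i = 0"] by auto
  then show ?thesis
    by (simp add: goodstein_terminates_def holds_goodstein_fm)
qed

end

theory Submission
  imports Defs "HOL-Library.Countable"
begin

text \<open>
  The proof is model-theoretic: it builds a model of \<open>I\<Sigma>\<^sub>1\<close> in which some multiplicative Goodstein
  sequence does not reach 0.

  A number written in base \<open>k\<close> with digits \<open>d\<^sub>r \<dots> d\<^sub>0\<close> is upgraded to the number with the same digits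
  in base \<open>k + 1\<close>, so a multiplicative Goodstein sequence is a countdown of digit strings, that is
  of ordinals below \<open>\<omega>\<^sup>\<omega>\<close>. Counting how the base grows, the countdown from \<open>k\<^sup>i\<close> in base \<open>k\<close> ends
  exactly in base \<open>F\<^sub>i(k)\<close>, where \<open>F\<^sub>i\<close> is the \<open>i\<close>-th fast-growing function (\<open>run_power\<close>). The length
  of the sequence that begins at \<open>2\<^sup>i\<close> is therefore beyond each fixed \<open>F\<^sub>n\<close>.

  Room of size \<open>F\<^sub>n\<close> is what is needed to build cuts that satisfy \<open>\<Sigma>\<^sub>1\<close> induction. Between \<open>b\<close> and
  \<open>F\<^sub>2\<^sub>n\<^sub>+\<^sub>1(b)\<close> there is a sequence \<open>b = b\<^sub>0 < \<dots> < b\<^sub>n\<close> such that, for the \<open>i\<close>-th \<open>\<Sigma>\<^sub>1\<close> formula and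
  arguments up to \<open>b\<^sub>i\<close>, least witnesses never lie strictly above \<open>b\<^sub>i\<^sub>+\<^sub>1\<close> and at most at \<open>b\<^sub>n\<close>
  (\<open>gap_sequence_exists\<close>): the interval is divided into more pieces than there are arguments, so
  that some piece contains no least witness. Now take such a sequence for every \<open>n\<close>, starting at
  \<open>m\<^sub>n = 2\<^bsup>2n+5\<^esup>\<close> and ending before the length of the Goodstein sequence of \<open>m\<^sub>n\<close>, and form an ultrapower
  of \<open>\<nat>\<close>. Its elements below some \<open>b\<^sub>i\<close> with standard \<open>i\<close> form an initial segment \<open>I\<close>. In \<open>I\<close>, a
  \<open>\<Sigma>\<^sub>1\<close> formula with arguments up to \<open>b\<^sub>i\<close> is equivalent to a formula whose quantifiers are bounded
  by a single element of \<open>I\<close>, and for those the least number principle holds coordinatewise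
  (\<open>sat_induction_fm\<close>). So \<open>I\<close> is a model of \<open>I\<Sigma>\<^sub>1\<close>. It contains the starting point \<open>(m\<^sub>n)\<close>, but all
  of its elements lie below the length of the corresponding sequence; since the formula expressing
  termination is preserved from \<open>I\<close> to the ultrapower (\<open>upward_goodstein_fm\<close>), termination fails
  in \<open>I\<close>.
\<close>

section \<open>The fast-growing hierarchy\<close>

primrec fast :: "nat \<Rightarrow> nat \<Rightarrow> nat" where
  "fast 0 x = Suc x"
| "fast (Suc i) x = (fast i ^^ Suc x) x"

lemma fast_greater: "x < fast i x"
proof (induction i arbitrary: x)
  case (Suc i)
  have "x \<le> (fast i ^^ j) x" for j
    by (induction j) (auto intro: order.trans less_imp_le[OF Suc])
  from le_less_trans[OF this Suc] show ?case by simp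
qed simp

lemma fast_mono: "x \<le> y \<Longrightarrow> fast i x \<le> fast i y"
proof (induction i arbitrary: x y)
  case (Suc i)
  then have "mono (fast i)"
    by (auto intro: monoI)
  then show ?case
    unfolding fast.simps using Suc.prems fast_greater
    by (intro funpow_mono2) (auto intro: less_imp_le)
qed simp

lemma fast_iter_mono: "j \<le> j' \<Longrightarrow> x \<le> y \<Longrightarrow> (fast i ^^ j) x \<le> (fast i ^^ j') y"
  by (intro funpow_mono2) (auto intro: monoI fast_mono less_imp_le[OF fast_greater])

lemma fast_iter_le: "j \<le> Suc x \<Longrightarrow> (fast i ^^ j) x \<le> fast (Suc i) x"
  unfolding fast.simps by (rule fast_iter_mono) auto

lemma fast_twice: "1 \<le> x \<Longrightarrow> fast i (fast i x) \<le> fast (Suc i) x"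
  using fast_iter_le[of 2 x i] by (simp add: numeral_2_eq_2)

lemma fast_level_mono: "i \<le> j \<Longrightarrow> fast i x \<le> fast j x"
  by (rule lift_Suc_mono_le[of "\<lambda>i. fast i x"]) (use fast_iter_le[of 1 x] in auto)

lemma fast_level_less: "1 \<le> x \<Longrightarrow> i < j \<Longrightarrow> fast i x < fast j x"
  using fast_greater[of "fast i x" i] fast_twice[of x i] fast_level_mono[of "Suc i" j x] by simp

lemma fast_1: "fast 1 x = 2 * x + 1"
proof -
  have "(fast 0 ^^ j) x = x + j" for j
    by (induction j) auto
  from this[of "Suc x"] show ?thesis by (simp only: fast.simps One_nat_def)
qed

lemma fast_ge_double: "1 \<le> i \<Longrightarrow> 2 * x + 1 \<le> fast i x"
  using fast_level_mono[of 1 i x] fast_1[of x] by simp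

text \<open>
  \<open>F\<^sub>1(x) + 1 = 2 (x + 1)\<close>, hence \<open>F\<^sub>2(x) + 1 = 2\<^bsup>x+1\<^esup> (x + 1)\<close>. The square is what makes the cuts
  below closed under multiplication.
\<close>

lemma fast_ge_square: "2 \<le> i \<Longrightarrow> (x + 1)\<^sup>2 \<le> fast i x"
proof -
  have iter: "(fast 1 ^^ j) x + 1 = 2 ^ j * (x + 1)" for j
    by (induction j) (simp_all add: fast_1 del: One_nat_def)
  have "Suc (Suc x) \<le> 2 ^ Suc x"
    using less_exp[of "Suc x"] by (simp only: Suc_le_eq)
  then have "Suc (Suc x) * Suc x \<le> 2 ^ Suc x * Suc x"
    by (rule mult_le_mono1)
  then have "(x + 1)\<^sup>2 \<le> fast 2 x"
    using iter[of "Suc x"] by (simp add: numeral_2_eq_2)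
  then show "(x + 1)\<^sup>2 \<le> fast i x" if "2 \<le> i"
    using fast_level_mono[OF that, of x] by linarith
qed

lemma two_power_le_fast: "2 ^ i \<le> fast i 2"
proof (induction i)
  case (Suc i)
  show ?case
  proof (cases "i = 0")
    case False
    then have "2 * fast i 2 \<le> fast i (fast i 2)"
      using fast_ge_double[of i "fast i 2"] by simp
    then show ?thesis
      using Suc fast_twice[of 2 i] by simp
  qed (use fast_1[of 2] in simp)
qed simp

text \<open>
  \<open>F\<^sub>i\<^sub>+\<^sub>1(2) = F\<^sub>i(F\<^sub>i(F\<^sub>i(2)))\<close>, and the two inner applications already reach \<open>2\<^bsup>i+1\<^esup>\<close>. This converts a
  bound in terms of the base 2 into one in terms of the starting number.
\<close>

lemma fast_two_power_le:
  assumes "1 \<le> i"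
  shows "fast i (2 ^ Suc i) \<le> fast (Suc i) 2"
proof -
  have "2 ^ Suc i \<le> fast i (fast i 2)"
    using two_power_le_fast[of i] fast_ge_double[OF assms, of "fast i 2"] by simp
  then have "fast i (2 ^ Suc i) \<le> (fast i ^^ 3) 2"
    using fast_mono by (simp add: numeral_3_eq_3)
  also have "\<dots> \<le> fast (Suc i) 2"
    by (rule fast_iter_le) simp
  finally show ?thesis .
qed

section \<open>Length of multiplicative Goodstein sequences\<close>

lemma mval_mnum: "mval l (mnum q) = q"
  by (induction q rule: mnum.induct) auto

lemma upgrade_less: "k \<ge> 2 \<Longrightarrow> v < k \<Longrightarrow> upgrade k l v = v"
  by (simp add: upgrade_def nf.simps[of k v] mval_mnum)

lemma upgrade_digit:
  assumes k: "k \<ge> 2" and q: "q < k"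
  shows "upgrade k l (k * p + q) = l * upgrade k l p + q"
proof (cases "p = 0")
  case True
  then show ?thesis using upgrade_less[OF k q] upgrade_less[OF k, of 0] k by simp
next
  case False
  then show ?thesis
    unfolding upgrade_def by (subst nf_step[OF k q refl]) (auto simp: mval_mnum)
qed

text \<open>
  Upgrading acts on the digits separately, so the lower digits can be split off.
\<close>

lemma upgrade_add:
  assumes k: "k \<ge> 2" and r: "r < k ^ i"
  shows "upgrade k l (h * k ^ i + r) = upgrade k l h * l ^ i + upgrade k l r"
  using r
proof (induction i arbitrary: r)
  case 0
  then show ?case using upgrade_less[of k 0 l] k by simp
next
  case (Suc i)
  define p q where "p = r div k" and "q = r mod k"
  have r: "r = k * p + q" and q: "q < k"
    using k by (simp_all add: p_def q_def)
  have p: "p < k ^ i"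
    using Suc.prems k by (simp add: p_def less_mult_imp_div_less mult.commute)
  have "upgrade k l (h * k ^ Suc i + r) = upgrade k l (k * (h * k ^ i + p) + q)"
    by (simp add: r algebra_simps)
  then show ?case
    unfolding upgrade_digit[OF k q] Suc.IH[OF p] r by (simp add: algebra_simps)
qed

lemma upgrade_bound:
  assumes k: "k \<ge> 2" and l: "k \<le> l" and r: "r < k ^ i"
  shows "upgrade k l r < l ^ i"
  using r
proof (induction i arbitrary: r)
  case 0
  then show ?case using upgrade_less[of k 0 l] k by simp
next
  case (Suc i)
  define p q where "p = r div k" and "q = r mod k"
  have r: "r = k * p + q" and q: "q < k"
    using k by (simp_all add: p_def q_def)
  have "p < k ^ i"
    using Suc.prems k by (simp add: p_def less_mult_imp_div_less mult.commute)
  then have "Suc (upgrade k l p) \<le> l ^ i"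
    using Suc.IH by (simp add: Suc_le_eq)
  then have "l * Suc (upgrade k l p) \<le> l * l ^ i"
    by (rule mult_le_mono2)
  then show ?case
    using q l upgrade_digit[OF k q, of l] by (simp add: r)
qed

lemma upgrade_pos: "k \<ge> 2 \<Longrightarrow> l > 0 \<Longrightarrow> v > 0 \<Longrightarrow> upgrade k l v > 0"
  by (simp add: upgrade_def nf_pos)

text \<open>
  The Goodstein process with the base made explicit: \<open>run k v k' v'\<close> says that \<open>v\<close> in base \<open>k\<close>
  becomes \<open>v'\<close> in base \<open>k'\<close>. The base serves as the clock.
\<close>

inductive run :: "nat \<Rightarrow> nat \<Rightarrow> nat \<Rightarrow> nat \<Rightarrow> bool" where
  stop: "run k v k v"
| step: "\<lbrakk>v > 0; run (Suc k) (upgrade k (Suc k) v - 1) k' v'\<rbrakk> \<Longrightarrow> run k v k' v'"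

lemma run_trans: "run k v k' v' \<Longrightarrow> run k' v' k'' v'' \<Longrightarrow> run k v k'' v''"
  by (induction rule: run.induct) (auto intro: run.step)

text \<open>
  The lower digits \<open>r\<close> count down on their own, without borrowing from the leading digit \<open>d\<close>, until
  they are used up.
\<close>

lemma run_lift:
  assumes "run k r k' 0" "2 \<le> k" "r < k ^ i" "d < k"
  shows "run k (d * k ^ i + r) k' (d * k' ^ i)"
proof -
  have "run k v k' v' \<Longrightarrow> v' = 0 \<Longrightarrow> 2 \<le> k \<Longrightarrow> v < k ^ i \<Longrightarrow> d < k \<Longrightarrow>
    run k (d * k ^ i + v) k' (d * k' ^ i)" for v v'
  proof (induction rule: run.induct)
    case (stop k v)
    then show ?case by (simp add: run.stop)
  next
    case (step v k k' v')
    let ?u = "upgrade k (Suc k)"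
    have "?u (d * k ^ i + v) - 1 = d * Suc k ^ i + (?u v - 1)"
      using step upgrade_pos[of k "Suc k" v] by (simp add: upgrade_add upgrade_less)
    moreover have "?u v - 1 < Suc k ^ i"
      using upgrade_bound[of k "Suc k" v i] step.prems by simp
    ultimately show ?case
      using step by (intro run.step[of "d * k ^ i + v" k]) auto
  qed
  with assms show ?thesis by blast
qed

text \<open>
  The first step from \<open>(d + 1) k\<^sup>i\<close> borrows from the leading digit and leaves the lower part
  \<open>(k + 1)\<^sup>i - 1\<close> in base \<open>k + 1\<close>, which is just what the first step from \<open>k\<^sup>i\<close> leaves.
\<close>

lemma run_borrow:
  assumes k: "2 \<le> k" and d: "Suc d < k" and run: "run k (k ^ i) k' 0"
  shows "run k (Suc d * k ^ i) k' (d * k' ^ i)"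
proof -
  have up: "upgrade k (Suc k) (h * k ^ i) = h * Suc k ^ i" if "h < k" for h
    using upgrade_add[OF k, of 0 i "Suc k" h] upgrade_less[OF k] that k by simp
  have "run (Suc k) (Suc k ^ i - 1) k' 0"
    using run up[of 1] k by (cases rule: run.cases) auto
  then have "run (Suc k) (d * Suc k ^ i + (Suc k ^ i - 1)) k' (d * k' ^ i)"
    using k d by (intro run_lift) auto
  moreover have "upgrade k (Suc k) (Suc d * k ^ i) - 1 = d * Suc k ^ i + (Suc k ^ i - 1)"
    using up[OF d] by simp
  ultimately have "run (Suc k) (upgrade k (Suc k) (Suc d * k ^ i) - 1) k' (d * k' ^ i)"
    by (simp only:)
  then show ?thesis
    by (rule run.step[rotated]) (use k in simp)
qed

text \<open>
  By \<open>run_borrow\<close>, counting down \<open>d k\<^sup>i\<close> takes the base from \<open>k\<close> to the \<open>d\<close>-th iterate of \<open>F\<^sub>i\<close> at \<open>k\<close>.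
  The first step from \<open>k\<^bsup>i+1\<^esup>\<close> yields \<open>(k + 1)\<^bsup>i+1\<^esup> - 1 = k (k + 1)\<^sup>i + ((k + 1)\<^sup>i - 1)\<close>: the second
  summand takes the base to \<open>F\<^sub>i(k)\<close>, and the remaining leading digit \<open>k\<close> accounts for \<open>k\<close> further
  applications of \<open>F\<^sub>i\<close>, which is the recursion for \<open>F\<^sub>i\<^sub>+\<^sub>1\<close>.
\<close>

lemma run_power: "2 \<le> k \<Longrightarrow> run k (k ^ i) (fast i k) 0"
proof (induction i arbitrary: k)
  case 0
  then show ?case using run.step[OF _ run.stop, of 1 k] by (simp add: upgrade_less)
next
  case (Suc i)
  note IH = Suc.IH
  have digits: "run k (d * k ^ i) ((fast i ^^ d) k) 0" if "2 \<le> k" "d < k" for d k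
    using that
  proof (induction d arbitrary: k)
    case (Suc d)
    have "run k (Suc d * k ^ i) (fast i k) (d * fast i k ^ i)"
      using Suc.prems by (intro run_borrow IH) auto
    moreover have "run (fast i k) (d * fast i k ^ i) ((fast i ^^ d) (fast i k)) 0"
      using Suc.prems fast_greater[of k i] by (intro Suc.IH) auto
    ultimately show ?case
      unfolding funpow_Suc_right comp_apply by (rule run_trans)
  qed (simp add: run.stop)
  have up: "upgrade k (Suc k) (k ^ j) = Suc k ^ j" for j
    using upgrade_add[OF Suc.prems, of 0 j "Suc k" 1] upgrade_less[OF Suc.prems] Suc.prems by simp
  \<comment> \<open>The first step from \<open>k\<^sup>i\<close> is forced, so the rest of its run is a run from \<open>(k + 1)\<^sup>i - 1\<close>.\<close>
  have "run (Suc k) (Suc k ^ i - 1) (fast i k) 0"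
    using Suc.IH[OF Suc.prems] up[of i] Suc.prems by (cases rule: run.cases) auto
  then have "run (Suc k) (k * Suc k ^ i + (Suc k ^ i - 1)) (fast i k) (k * fast i k ^ i)"
    using Suc.prems by (intro run_lift) auto
  moreover have "run (fast i k) (k * fast i k ^ i) ((fast i ^^ k) (fast i k)) 0"
    using Suc.prems fast_greater[of k i] by (intro digits) auto
  ultimately have "run (Suc k) (k * Suc k ^ i + (Suc k ^ i - 1)) (fast (Suc i) k) 0"
    unfolding fast.simps funpow_Suc_right comp_apply by (rule run_trans)
  moreover have "upgrade k (Suc k) (k ^ Suc i) - 1 = k * Suc k ^ i + (Suc k ^ i - 1)"
    using up[of "Suc i"] by simp
  ultimately have "run (Suc k) (upgrade k (Suc k) (k ^ Suc i) - 1) (fast (Suc i) k) 0"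
    by (simp only:)
  then show ?case
    by (rule run.step[rotated]) (use Suc.prems in simp)
qed

lemma run_imp_goodstein_pos:
  "run k v k' v' \<Longrightarrow> k = j + 2 \<Longrightarrow> v = goodstein m j \<Longrightarrow> j \<le> i \<Longrightarrow> i + 2 < k' \<Longrightarrow> 0 < goodstein m i"
proof (induction arbitrary: j rule: run.induct)
  case (step v k k' v')
  show ?case
  proof (cases "i = j")
    case False
    then show ?thesis
      using step.hyps step.prems by (intro step.IH[of "Suc j"]) (auto simp: numeral_3_eq_3)
  qed (use step in auto)
qed simp

lemma goodstein_two_power_pos:
  assumes "i + 2 < fast j 2"
  shows "0 < goodstein (2 ^ j) i"
  using run_imp_goodstein_pos[OF run_power[of 2 j], of 0] assms by simp

section \<open>Sequences with gaps\<close>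

text \<open>
  Read \<open>Q i w p\<close> as \<open>the i-th problem with parameter p has a witness up to w\<close>. A problem with a
  parameter up to \<open>b i\<close> that is solved below \<open>b n\<close> must be solved below \<open>b (i + 1)\<close> already.
\<close>

definition gap_sequence :: "(nat \<Rightarrow> nat \<Rightarrow> nat \<Rightarrow> bool) \<Rightarrow> nat \<Rightarrow> (nat \<Rightarrow> nat) \<Rightarrow> bool" where
  "gap_sequence Q n b \<longleftrightarrow> (\<forall>i<n. (b i + 1)\<^sup>2 \<le> b (Suc i) \<and>
     (\<forall>p\<le>b i. Q i (b n) p \<longrightarrow> Q i (b (Suc i)) p))"

lemma gap_sequence_mono:
  assumes "gap_sequence Q n b" "i \<le> j" "j \<le> n"
  shows "b i \<le> b j"
  using assms(2,3)
proof (induction j rule: dec_induct)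
  case (step j)
  have "b j \<le> (b j + 1)\<^sup>2"
    by (simp add: power2_eq_square)
  also have "\<dots> \<le> b (Suc j)"
    using assms(1) step.prems by (simp add: gap_sequence_def)
  finally show ?case
    using step by simp
qed simp

text \<open>
  Starting at \<open>B = (b + 1)\<^sup>2\<close>, the iterates of \<open>F\<^sub>n\<close> divide the interval up to \<open>F\<^sub>n\<^sub>+\<^sub>1(B) \<le> F\<^sub>n\<^sub>+\<^sub>2(b)\<close>
  into \<open>B + 1\<close> pieces. As \<open>Q\<close> is monotone in the bound, each parameter becomes solved in at most one
  piece; there are only \<open>b + 1\<close> parameters, so some piece is a gap for all of them. One gap costs two
  levels of the hierarchy.
\<close>

lemma fast_gap:
  assumes n: "1 \<le> n" and b: "1 \<le> b" and c: "fast (n + 2) b \<le> c"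
    and mono: "\<And>w w' p. w \<le> w' \<Longrightarrow> Q w p \<Longrightarrow> Q w' p"
  shows "\<exists>b'. (b + 1)\<^sup>2 \<le> b' \<and> fast n b' \<le> c \<and> (\<forall>p\<le>b. Q (fast n b') p \<longrightarrow> Q b' p)"
proof (rule ccontr)
  assume no_gap: "\<not> ?thesis"
  define B where "B = (b + 1)\<^sup>2"
  define x where "x j = (fast n ^^ j) B" for j
  have x_mono: "x i \<le> x j" if "i \<le> j" for i j
    unfolding x_def using that by (rule fast_iter_mono) simp
  have "fast (Suc n) B \<le> fast (Suc n) (fast (Suc n) b)"
    unfolding B_def using n by (intro fast_mono fast_ge_square) simp
  also have "\<dots> \<le> c"
    using fast_twice[OF b, of "Suc n"] c by simp
  finally have "x (Suc B) \<le> c"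
    by (simp add: x_def)
  have "\<exists>p\<le>b. Q (x (Suc j)) p \<and> \<not> Q (x j) p" if "j \<le> Suc b" for j
  proof -
    have "j \<le> B"
      using that by (simp add: B_def power2_eq_square)
    then have "fast n (x j) \<le> c"
      using x_mono[of "Suc j" "Suc B"] \<open>x (Suc B) \<le> c\<close> by (simp add: x_def)
    moreover have "B \<le> x j"
      using x_mono[of 0 j] by (simp add: x_def)
    ultimately show ?thesis
      using no_gap by (auto simp: B_def x_def)
  qed
  then obtain f where f: "\<And>j. j \<le> Suc b \<Longrightarrow> f j \<le> b \<and> Q (x (Suc j)) (f j) \<and> \<not> Q (x j) (f j)"
    by metis
  \<comment> \<open>Once solved, a parameter stays solved, so it cannot become solved again in a later piece.\<close>
  have neq: "f i \<noteq> f j" if "i < j" "j \<le> Suc b" for i j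
    using f[of i] f[of j] mono[OF x_mono[of "Suc i" j], of "f i"] that by auto
  have "inj_on f {..Suc b}"
    by (rule linorder_inj_onI) (use neq in auto)
  moreover have "f ` {..Suc b} \<subseteq> {..b}"
    using f by auto
  ultimately have "card {..Suc b} \<le> card {..b}"
    by (metis card_inj_on_le finite_atMost)
  then show False by simp
qed

lemma gap_sequence_exists:
  assumes "1 \<le> b" "fast (2 * n + 1) b \<le> c"
    and "\<And>i w w' p. w \<le> w' \<Longrightarrow> Q i w p \<Longrightarrow> Q i w' p"
  shows "\<exists>\<beta>. \<beta> 0 = b \<and> \<beta> n \<le> c \<and> gap_sequence Q n \<beta>"
  using assms
proof (induction n arbitrary: b c Q)
  case 0
  then have "b \<le> c"
    using fast_greater[of b 1] by simp
  then show ?case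
    by (intro exI[of _ "\<lambda>_. b"]) (simp add: gap_sequence_def)
next
  case (Suc n)
  have "fast (2 * n + 1 + 2) b \<le> c"
    using Suc.prems(2) by (simp add: numeral_2_eq_2)
  then obtain b' where b': "(b + 1)\<^sup>2 \<le> b'" "fast (2 * n + 1) b' \<le> c"
    and gap: "\<And>p. p \<le> b \<Longrightarrow> Q 0 (fast (2 * n + 1) b') p \<Longrightarrow> Q 0 b' p"
    using fast_gap[of "2 * n + 1" b c "Q 0"] Suc.prems by auto
  have "1 \<le> b'"
    using b'(1) by (simp add: power2_eq_square)
  then obtain \<beta> where \<beta>: "\<beta> 0 = b'" "\<beta> n \<le> fast (2 * n + 1) b'" "gap_sequence (\<lambda>i. Q (Suc i)) n \<beta>"
    using Suc.IH[OF _ order.refl, of b' "\<lambda>i. Q (Suc i)"] Suc.prems(3) by blast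
  have "gap_sequence Q (Suc n) (case_nat b \<beta>)"
    unfolding gap_sequence_def
  proof (intro allI impI)
    fix i assume "i < Suc n"
    then show "(case_nat b \<beta> i + 1)\<^sup>2 \<le> case_nat b \<beta> (Suc i) \<and>
      (\<forall>p\<le>case_nat b \<beta> i. Q i (case_nat b \<beta> (Suc n)) p \<longrightarrow> Q i (case_nat b \<beta> (Suc i)) p)"
      using \<beta> b'(1) gap Suc.prems(3)[OF \<beta>(2)] by (cases i) (auto simp: gap_sequence_def)
  qed
  with \<beta> b'(2) show ?case
    by (intro exI[of _ "case_nat b \<beta>"]) simp
qed

section \<open>Ultrafilters\<close>

text \<open>
  A filter that is minimal among the proper ones below \<open>F\<close> decides every property: otherwise it could
  be refined by that property.
\<close>

lemma ultrafilter_exists: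
  fixes F :: "'a filter"
  assumes "F \<noteq> bot"
  obtains U where "U \<le> F" "U \<noteq> bot" "\<And>P. eventually P U \<or> eventually (\<lambda>x. \<not> P x) U"
proof -
  define A where "A = {G. G \<le> F \<and> G \<noteq> bot}"
  let ?P = "\<lambda>G H :: 'a filter. H \<le> G"
  have "\<exists>m\<in>A. \<forall>a\<in>A. a \<le> m \<longrightarrow> a = m"
  proof (rule predicate_Zorn)
    show "partial_order_on A (relation_of ?P A)"
      by (rule partial_order_on_relation_ofI) auto
  next
    fix C assume C: "C \<in> Chains (relation_of ?P A)"
    then have sub: "C \<subseteq> A" and tot: "\<And>G H. G \<in> C \<Longrightarrow> H \<in> C \<Longrightarrow> G \<le> H \<or> H \<le> G"
      by (auto simp: Chains_def relation_of_def)
    show "\<exists>u\<in>A. \<forall>a\<in>C. u \<le> a"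
    proof (cases "C = {}")
      case True
      then show ?thesis using assms by (auto simp: A_def)
    next
      case False
      have "eventually P (Inf C) \<longleftrightarrow> (\<exists>b\<in>C. eventually P b)" for P
        using False
      proof (rule eventually_Inf_base)
        fix G H assume "G \<in> C" "H \<in> C"
        with tot[of G H] show "\<exists>x\<in>C. x \<le> inf G H" by auto
      qed
      then have "Inf C \<noteq> bot"
        using sub by (auto simp: A_def trivial_limit_def)
      moreover have "Inf C \<le> F"
        using False sub by (auto simp: A_def intro: Inf_lower2)
      ultimately show ?thesis
        by (auto simp: A_def intro!: bexI[of _ "Inf C"] Inf_lower)
    qed
  qed
  then obtain U where U: "U \<in> A" "\<And>G. G \<in> A \<Longrightarrow> G \<le> U \<Longrightarrow> G = U"
    by blast
  have "eventually P U \<or> eventually (\<lambda>x. \<not> P x) U" for P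
  proof (cases "inf U (principal {x. P x}) = bot")
    case True
    then show ?thesis
      by (simp add: trivial_limit_def eventually_inf_principal)
  next
    case False
    then have "inf U (principal {x. P x}) = U"
      using U(1) by (intro U(2)) (auto simp: A_def intro: le_infI1)
    moreover have "eventually P (inf U (principal {x. P x}))"
      by (simp add: eventually_inf_principal)
    ultimately show ?thesis by simp
  qed
  with U(1) show thesis
    by (intro that) (auto simp: A_def)
qed

section \<open>Coding of assignments and bounded truth\<close>

text \<open>
  The formula \<open>\<exists> \<dots> \<exists> \<theta>\<close> with \<open>k\<close> quantifiers, all of them bounded by \<open>w\<close>. One common bound for the
  whole block makes this monotone in \<open>w\<close>, and it is the notion of witness used for \<open>\<Sigma>\<^sub>1\<close> formulas.
\<close>

fun bex_upto :: "nat \<Rightarrow> fm \<Rightarrow> nat \<Rightarrow> (nat \<Rightarrow> nat) \<Rightarrow> bool" where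
  "bex_upto 0 \<theta> w e \<longleftrightarrow> holds e \<theta>"
| "bex_upto (Suc k) \<theta> w e \<longleftrightarrow> (\<exists>x\<le>w. bex_upto k \<theta> w (case_nat x e))"

lemma bex_upto_mono: "bex_upto k \<theta> w e \<Longrightarrow> w \<le> w' \<Longrightarrow> bex_upto k \<theta> w' e"
  by (induction k arbitrary: e) (auto intro: order.trans)

lemma tm_val_cong: "below_tm N t \<Longrightarrow> (\<And>i. i < N \<Longrightarrow> e i = e' i) \<Longrightarrow> tm_val e t = tm_val e' t"
  by (induction t) auto

lemma case_nat_agree:
  "(\<And>i. i < N \<Longrightarrow> e i = e' i) \<Longrightarrow> i < Suc N \<Longrightarrow> (case_nat x e i :: nat) = case_nat x e' i"
  by (auto split: nat.split)

lemma holds_cong: "below N \<phi> \<Longrightarrow> (\<And>i. i < N \<Longrightarrow> e i = e' i) \<Longrightarrow> holds e \<phi> = holds e' \<phi>"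
proof (induction \<phi> arbitrary: N e e')
  case (Eq s t)
  then show ?case using tm_val_cong[of N _ e e'] by simp
next
  case (Le s t)
  then show ?case using tm_val_cong[of N _ e e'] by simp
next
  case (All \<phi>)
  have "holds (case_nat x e) \<phi> = holds (case_nat x e') \<phi>" for x
    using All.prems by (intro All.IH[of "Suc N"] case_nat_agree[of N]) auto
  then show ?case by simp
next
  case (Ex \<phi>)
  have "holds (case_nat x e) \<phi> = holds (case_nat x e') \<phi>" for x
    using Ex.prems by (intro Ex.IH[of "Suc N"] case_nat_agree[of N]) auto
  then show ?case by simp
next
  case (Imp \<phi> \<psi>)
  then show ?case by (metis below.simps(4) holds.simps(4))
next
  case (And \<phi> \<psi>)
  then show ?case by (metis below.simps(5) holds.simps(5))
next
  case (Or \<phi> \<psi>)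
  then show ?case by (metis below.simps(6) holds.simps(6))
qed simp

lemma bex_upto_cong:
  "below N ((Ex ^^ k) \<theta>) \<Longrightarrow> (\<And>i. i < N \<Longrightarrow> e i = e' i) \<Longrightarrow> bex_upto k \<theta> w e = bex_upto k \<theta> w e'"
proof (induction k arbitrary: N e e')
  case 0
  then show ?case using holds_cong[of N \<theta> e e'] by simp
next
  case (Suc k)
  have "bex_upto k \<theta> w (case_nat x e) = bex_upto k \<theta> w (case_nat x e')" for x
    using Suc.prems by (intro Suc.IH[of "Suc N"] case_nat_agree[of N]) auto
  then show ?case by simp
qed

text \<open>
  Numbers as assignments, so that a problem depends on a single numerical parameter whatever its
  number of free variables is.
\<close>

definition env :: "nat \<Rightarrow> nat \<Rightarrow> nat" where
  "env p i = (let xs = list_decode p in if i < length xs then xs ! i else 0)"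

lemma env_list_encode: "i < length xs \<Longrightarrow> env (list_encode xs) i = xs ! i"
  by (simp add: env_def)

lemma sigma1_imp_Ex_delta0: "sigma1 \<phi> \<Longrightarrow> \<exists>k \<theta>. delta0 \<theta> \<and> \<phi> = (Ex ^^ k) \<theta>"
proof (induction rule: sigma1.induct)
  case (1 \<phi>)
  then show ?case by (intro exI[of _ 0] exI[of _ \<phi>]) simp
next
  case (2 \<phi>)
  then obtain k \<theta> where "delta0 \<theta>" "\<phi> = (Ex ^^ k) \<theta>" by blast
  then show ?case by (intro exI[of _ "Suc k"] exI[of _ \<theta>]) simp
qed

lemma below_All_funpow: "below N ((All ^^ n) \<phi>) \<longleftrightarrow> below (N + n) \<phi>"
  by (induction n arbitrary: N) auto

section \<open>Cuts of an ultrapower of the natural numbers\<close>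

text \<open>
  A sequence of numbers represents an element of the ultrapower, and an assignment \<open>e\<close> maps variables
  to such sequences; \<open>coord e n\<close> is the assignment in the \<open>n\<close>-th copy of \<open>\<nat>\<close>.
\<close>

definition coord :: "(nat \<Rightarrow> nat \<Rightarrow> nat) \<Rightarrow> nat \<Rightarrow> nat \<Rightarrow> nat" where
  "coord e n = (\<lambda>i. e i n)"

lemma coord_case_nat [simp]: "coord (case_nat x e) n = case_nat (x n) (coord e n)"
  by (auto simp: coord_def fun_eq_iff split: nat.split)

definition val :: "(nat \<Rightarrow> nat \<Rightarrow> nat) \<Rightarrow> tm \<Rightarrow> nat \<Rightarrow> nat" where
  "val e t = (\<lambda>n. tm_val (coord e n) t)"

lemma val_subst_tm: "val e (subst_tm \<sigma> t) = val (\<lambda>i. val e (\<sigma> i)) t"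
  by (simp add: val_def tm_val_subst coord_def)

lemma val_under: "(\<lambda>i. val (case_nat x e) (under \<sigma> i)) = case_nat x (\<lambda>i. val e (\<sigma> i))"
  by (auto simp: fun_eq_iff under_def val_def split: nat.split)

text \<open>
  An initial segment \<open>D\<close> of the ultrapower of \<open>\<nat>\<close> by the ultrafilter \<open>U\<close>, closed under the arithmetical
  operations. No quotient is formed: equality is interpreted as equality almost everywhere, which
  is a congruence (\<open>sat_cong\<close>).
\<close>

locale cut =
  fixes U :: "nat filter" and D :: "(nat \<Rightarrow> nat) set"
  assumes nontrivial: "U \<noteq> bot"
    and ultra: "eventually P U \<or> eventually (\<lambda>n. \<not> P n) U"
    and D_downward: "\<lbrakk>f \<in> D; eventually (\<lambda>n. g n \<le> f n) U\<rbrakk> \<Longrightarrow> g \<in> D"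
    and D_zero: "(\<lambda>n. 0) \<in> D"
    and D_Suc: "f \<in> D \<Longrightarrow> (\<lambda>n. Suc (f n)) \<in> D"
    and D_add: "\<lbrakk>f \<in> D; g \<in> D\<rbrakk> \<Longrightarrow> (\<lambda>n. f n + g n) \<in> D"
    and D_mult: "\<lbrakk>f \<in> D; g \<in> D\<rbrakk> \<Longrightarrow> (\<lambda>n. f n * g n) \<in> D"
begin

lemma ev_not: "eventually (\<lambda>n. \<not> P n) U \<longleftrightarrow> \<not> eventually P U"
  using ultra[of P] nontrivial eventually_elim2[of P U "\<lambda>n. \<not> P n" "\<lambda>n. False"]
  by (auto simp: trivial_limit_def)

lemma ev_imp: "eventually (\<lambda>n. P n \<longrightarrow> Q n) U \<longleftrightarrow> (eventually P U \<longrightarrow> eventually Q U)"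
  using ev_not[of P] by (auto elim: eventually_mono intro: eventually_mp)

lemma ev_disj: "eventually (\<lambda>n. P n \<or> Q n) U \<longleftrightarrow> eventually P U \<or> eventually Q U"
  using ev_imp[of "\<lambda>n. \<not> P n" Q] by (simp add: ev_not disj_imp)

primrec sat :: "(nat \<Rightarrow> nat \<Rightarrow> nat) \<Rightarrow> fm \<Rightarrow> bool" where
  "sat e Fls \<longleftrightarrow> False"
| "sat e (s \<^bold>= t) \<longleftrightarrow> (\<forall>\<^sub>F n in U. val e s n = val e t n)"
| "sat e (s \<^bold>\<le> t) \<longleftrightarrow> (\<forall>\<^sub>F n in U. val e s n \<le> val e t n)"
| "sat e (\<phi> \<^bold>\<longrightarrow> \<psi>) \<longleftrightarrow> (sat e \<phi> \<longrightarrow> sat e \<psi>)"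
| "sat e (\<phi> \<^bold>\<and> \<psi>) \<longleftrightarrow> sat e \<phi> \<and> sat e \<psi>"
| "sat e (\<phi> \<^bold>\<or> \<psi>) \<longleftrightarrow> sat e \<phi> \<or> sat e \<psi>"
| "sat e (\<^bold>\<forall> \<phi>) \<longleftrightarrow> (\<forall>x\<in>D. sat (case_nat x e) \<phi>)"
| "sat e (\<^bold>\<exists> \<phi>) \<longleftrightarrow> (\<exists>x\<in>D. sat (case_nat x e) \<phi>)"

definition assignment :: "(nat \<Rightarrow> nat \<Rightarrow> nat) \<Rightarrow> bool" where
  "assignment e \<longleftrightarrow> (\<forall>i. e i \<in> D)"

lemma assignment_case_nat [simp]: "assignment (case_nat x e) \<longleftrightarrow> x \<in> D \<and> assignment e"
  unfolding assignment_def by (metis Nitpick.case_nat_unfold old.nat.simps(4,5))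

lemma val_in_D: "assignment e \<Longrightarrow> val e t \<in> D"
  by (induction t) (auto simp: val_def coord_def assignment_def D_zero D_Suc D_add D_mult)

lemma sat_subst: "sat e (subst \<sigma> \<phi>) \<longleftrightarrow> sat (\<lambda>i. val e (\<sigma> i)) \<phi>"
  by (induction \<phi> arbitrary: e \<sigma>) (simp_all add: val_subst_tm val_under)

lemma val_Var: "val e (Var i) = e i"
  by (simp add: val_def coord_def)

lemma sat_lift_fm: "sat (case_nat x e) (lift_fm \<phi>) \<longleftrightarrow> sat e \<phi>"
  by (simp add: lift_fm_def sat_subst val_Var)

lemma sat_inst: "sat e (inst t \<phi>) \<longleftrightarrow> sat (case_nat (val e t) e) \<phi>"
proof -
  have "(\<lambda>i. val e (case_nat t Var i)) = case_nat (val e t) e"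
    by (auto simp: fun_eq_iff val_Var split: nat.split)
  then show ?thesis by (simp add: inst_def sat_subst)
qed

lemma val_cong:
  assumes "\<And>i. \<forall>\<^sub>F n in U. e i n = e' i n"
  shows "\<forall>\<^sub>F n in U. val e t n = val e' t n"
proof (induction t)
  case (Var i)
  then show ?case using assms by (simp add: val_Var)
qed (auto simp: val_def elim: eventually_elim2)

lemma sat_cong:
  assumes "\<And>i. \<forall>\<^sub>F n in U. e i n = e' i n"
  shows "sat e \<phi> \<longleftrightarrow> sat e' \<phi>"
  using assms
proof (induction \<phi> arbitrary: e e')
  case (Eq s t)
  have "\<forall>\<^sub>F n in U. (val e s n = val e t n) = (val e' s n = val e' t n)"
    using val_cong[of e e' s, OF Eq] val_cong[of e e' t, OF Eq] by eventually_elim auto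
  then show ?case by (simp add: eventually_subst)
next
  case (Le s t)
  have "\<forall>\<^sub>F n in U. (val e s n \<le> val e t n) = (val e' s n \<le> val e' t n)"
    using val_cong[of e e' s, OF Le] val_cong[of e e' t, OF Le] by eventually_elim auto
  then show ?case by (simp add: eventually_subst)
next
  case (All \<phi>)
  have "sat (case_nat x e) \<phi> = sat (case_nat x e') \<phi>" for x
    using All.prems by (intro All.IH) (auto split: nat.split)
  then show ?case by simp
next
  case (Ex \<phi>)
  have "sat (case_nat x e) \<phi> = sat (case_nat x e') \<phi>" for x
    using Ex.prems by (intro Ex.IH) (auto split: nat.split)
  then show ?case by simp
next
  case (Imp \<phi> \<psi>)
  then show ?case by (metis sat.simps(4))
next
  case (And \<phi> \<psi>)
  then show ?case by (metis sat.simps(5))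
next
  case (Or \<phi> \<psi>)
  then show ?case by (metis sat.simps(6))
qed simp

theorem soundness:
  "\<Gamma> \<turnstile> \<phi> \<Longrightarrow> assignment e \<Longrightarrow> (\<And>\<psi>. \<psi> \<in> \<Gamma> \<Longrightarrow> sat e \<psi>) \<Longrightarrow> sat e \<phi>"
proof (induction arbitrary: e rule: deriv.induct)
  case (Contr \<phi> \<Gamma>)
  have "sat e Fls" if "\<not> sat e \<phi>"
    using that Contr.prems by (intro Contr.IH) auto
  then show ?case by auto
next
  case (ImpI \<phi> \<Gamma> \<psi>)
  have "sat e \<psi>" if "sat e \<phi>"
    using that ImpI.prems by (intro ImpI.IH) auto
  then show ?case by simp
next
  case (ImpE \<Gamma> \<phi> \<psi>)
  then show ?case by (metis sat.simps(4))
next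
  case (OrE \<Gamma> \<phi> \<psi> \<chi>)
  have "sat e (\<phi> \<^bold>\<or> \<psi>)"
    using OrE.prems by (intro OrE.IH)
  moreover have "sat e \<chi>" if "sat e \<phi>"
    using that OrE.prems by (intro OrE.IH(2)) auto
  moreover have "sat e \<chi>" if "sat e \<psi>"
    using that OrE.prems by (intro OrE.IH(3)) auto
  ultimately show ?case by auto
next
  case (AllI \<Gamma> \<phi>)
  have "sat (case_nat x e) \<phi>" if "x \<in> D" for x
    using that AllI.prems by (intro AllI.IH) (auto simp: sat_lift_fm)
  then show ?case by simp
next
  case (AllE \<Gamma> \<phi> t)
  have "sat e (\<^bold>\<forall> \<phi>)"
    using AllE.prems by (intro AllE.IH)
  then show ?case
    using val_in_D[OF AllE.prems(1)] by (simp add: sat_inst)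
next
  case (ExI \<Gamma> t \<phi>)
  have "sat e (inst t \<phi>)"
    using ExI.prems by (intro ExI.IH)
  then show ?case
    using val_in_D[OF ExI.prems(1)] by (auto simp: sat_inst)
next
  case (ExE \<Gamma> \<phi> \<psi>)
  have "sat e (\<^bold>\<exists> \<phi>)"
    using ExE.prems by (intro ExE.IH)
  then obtain x where x: "x \<in> D" "sat (case_nat x e) \<phi>" by auto
  have "sat (case_nat x e) (lift_fm \<psi>)"
    using x ExE.prems by (intro ExE.IH(2)) (auto simp: sat_lift_fm)
  then show ?case by (simp add: sat_lift_fm)
next
  case (Replace \<Gamma> s t \<phi>)
  have eq: "sat e (s \<^bold>= t)"
    using Replace.prems by (intro Replace.IH(1))
  have s: "sat e (inst s \<phi>)"
    using Replace.prems by (intro Replace.IH(2))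
  have "sat (case_nat (val e s) e) \<phi> = sat (case_nat (val e t) e) \<phi>"
    using eq by (intro sat_cong) (auto split: nat.split)
  with s show ?case by (simp add: sat_inst)
qed auto

text \<open>
  Counterexamples in the single copies of \<open>\<nat>\<close> combine to one sequence, and being bounded by \<open>f\<close> it
  belongs to the initial segment.
\<close>

lemma ev_ball:
  assumes "f \<in> D"
  shows "(\<forall>\<^sub>F n in U. \<forall>x\<le>f n. P n x) \<longleftrightarrow>
    (\<forall>x\<in>D. (\<forall>\<^sub>F n in U. x n \<le> f n) \<longrightarrow> (\<forall>\<^sub>F n in U. P n (x n)))"
proof
  assume "\<forall>\<^sub>F n in U. \<forall>x\<le>f n. P n x"
  then show "\<forall>x\<in>D. (\<forall>\<^sub>F n in U. x n \<le> f n) \<longrightarrow> (\<forall>\<^sub>F n in U. P n (x n))"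
    by (auto elim: eventually_elim2)
next
  assume *: "\<forall>x\<in>D. (\<forall>\<^sub>F n in U. x n \<le> f n) \<longrightarrow> (\<forall>\<^sub>F n in U. P n (x n))"
  define x where "x n = (if \<forall>x\<le>f n. P n x then 0 else SOME x. x \<le> f n \<and> \<not> P n x)" for n
  have x: "x n \<le> f n \<and> ((\<forall>x\<le>f n. P n x) \<or> \<not> P n (x n))" for n
    using someI_ex[of "\<lambda>x. x \<le> f n \<and> \<not> P n x"] by (auto simp: x_def)
  then have "x \<in> D"
    using assms by (auto intro: D_downward)
  with * x have "\<forall>\<^sub>F n in U. P n (x n)" by auto
  then show "\<forall>\<^sub>F n in U. \<forall>x\<le>f n. P n x"
    by (rule eventually_mono) (use x in auto)
qed

lemma ev_bex:
  assumes "f \<in> D"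
  shows "(\<forall>\<^sub>F n in U. \<exists>x\<le>f n. P n x) \<longleftrightarrow>
    (\<exists>x\<in>D. (\<forall>\<^sub>F n in U. x n \<le> f n) \<and> (\<forall>\<^sub>F n in U. P n (x n)))"
  using ev_ball[OF assms, of "\<lambda>n x. \<not> P n x"] ev_not[of "\<lambda>n. \<exists>x\<le>f n. P n x"]
  by (auto simp: ev_not)

lemma val_lift: "val (case_nat x e) (lift 1 t) = val e t"
  by (simp add: val_def del: One_nat_def)

lemma val_Var_0: "val (case_nat x e) (Var 0) = x"
  by (simp add: val_Var)

text \<open>
  The theorem of Los for bounded formulas: here it holds for the initial segment and not only for
  the whole ultrapower, because the witnesses of bounded quantifiers stay in the segment.
\<close>

lemma sat_delta0:
  "delta0 \<phi> \<Longrightarrow> assignment e \<Longrightarrow> sat e \<phi> \<longleftrightarrow> (\<forall>\<^sub>F n in U. holds (coord e n) \<phi>)"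
proof (induction arbitrary: e rule: delta0.induct)
  case (7 \<phi> t)
  have "sat e (\<^bold>\<forall>\<^bold>\<le> t. \<phi>) \<longleftrightarrow> (\<forall>x\<in>D. (\<forall>\<^sub>F n in U. x n \<le> val e t n) \<longrightarrow>
    (\<forall>\<^sub>F n in U. holds (case_nat (x n) (coord e n)) \<phi>))"
    unfolding ball_def sat.simps val_lift val_Var_0 using 7 by simp
  also have "\<dots> \<longleftrightarrow> (\<forall>\<^sub>F n in U. holds (coord e n) (\<^bold>\<forall>\<^bold>\<le> t. \<phi>))"
    using ev_ball[OF val_in_D[OF 7(3)], of t "\<lambda>n x. holds (case_nat x (coord e n)) \<phi>"]
    by (simp add: val_def)
  finally show ?case .
next
  case (8 \<phi> t)
  have "sat e (\<^bold>\<exists>\<^bold>\<le> t. \<phi>) \<longleftrightarrow> (\<exists>x\<in>D. (\<forall>\<^sub>F n in U. x n \<le> val e t n) \<and>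
    (\<forall>\<^sub>F n in U. holds (case_nat (x n) (coord e n)) \<phi>))"
    unfolding bex_def sat.simps val_lift val_Var_0 using 8 by simp
  also have "\<dots> \<longleftrightarrow> (\<forall>\<^sub>F n in U. holds (coord e n) (\<^bold>\<exists>\<^bold>\<le> t. \<phi>))"
    using ev_bex[OF val_in_D[OF 8(3)], of t "\<lambda>n x. holds (case_nat x (coord e n)) \<phi>"]
    by (simp add: val_def)
  finally show ?case .
qed (simp_all add: val_def ev_imp ev_disj eventually_conj_iff nontrivial)

lemma sat_Ex_funpow:
  assumes "delta0 \<theta>" "assignment e"
  shows "sat e ((Ex ^^ k) \<theta>) \<longleftrightarrow> (\<exists>w\<in>D. \<forall>\<^sub>F n in U. bex_upto k \<theta> (w n) (coord e n))"
  using assms(2)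
proof (induction k arbitrary: e)
  case 0
  then show ?case using sat_delta0[OF assms(1)] D_zero by auto
next
  case (Suc k)
  show ?case
  proof
    assume "sat e ((Ex ^^ Suc k) \<theta>)"
    then obtain x w where xw: "x \<in> D" "w \<in> D" "\<forall>\<^sub>F n in U. bex_upto k \<theta> (w n) (case_nat (x n) (coord e n))"
      using Suc by auto
    have "\<forall>\<^sub>F n in U. bex_upto (Suc k) \<theta> (x n + w n) (coord e n)"
      using xw(3)
    proof eventually_elim
      case (elim n)
      then show ?case
        using bex_upto_mono[OF elim, of "x n + w n"] by (auto intro!: exI[of _ "x n"])
    qed
    then show "\<exists>w\<in>D. \<forall>\<^sub>F n in U. bex_upto (Suc k) \<theta> (w n) (coord e n)"
      using D_add[OF xw(1,2)] by (intro bexI[of _ "\<lambda>n. x n + w n"])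
  next
    assume "\<exists>w\<in>D. \<forall>\<^sub>F n in U. bex_upto (Suc k) \<theta> (w n) (coord e n)"
    then obtain w where w: "w \<in> D" "\<forall>\<^sub>F n in U. \<exists>x\<le>w n. bex_upto k \<theta> (w n) (case_nat x (coord e n))"
      by auto
    then obtain x where "x \<in> D" "\<forall>\<^sub>F n in U. bex_upto k \<theta> (w n) (case_nat (x n) (coord e n))"
      using ev_bex[OF w(1), of "\<lambda>n x. bex_upto k \<theta> (w n) (case_nat x (coord e n))"] by auto
    then show "sat e ((Ex ^^ Suc k) \<theta>)"
      using w(1) Suc by auto
  qed
qed

text \<open>
  Truth in the segment implies truth almost everywhere. This holds for \<open>\<Sigma>\<^sub>1\<close> formulas, and more
  generally for formulas in which unbounded existential quantifiers occur positively, possibly in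
  the scope of bounded quantifiers, such as the formula for Goodstein sequences.
\<close>

definition upward :: "fm \<Rightarrow> bool" where
  "upward \<phi> \<longleftrightarrow> (\<forall>e. assignment e \<longrightarrow> sat e \<phi> \<longrightarrow> (\<forall>\<^sub>F n in U. holds (coord e n) \<phi>))"

lemma upwardI: "(\<And>e. assignment e \<Longrightarrow> sat e \<phi> \<Longrightarrow> \<forall>\<^sub>F n in U. holds (coord e n) \<phi>) \<Longrightarrow> upward \<phi>"
  by (simp add: upward_def)

lemma upward_case_nat:
  "\<lbrakk>upward \<phi>; assignment e; x \<in> D; sat (case_nat x e) \<phi>\<rbrakk>
    \<Longrightarrow> \<forall>\<^sub>F n in U. holds (case_nat (x n) (coord e n)) \<phi>"
  by (auto simp: upward_def dest: spec[of _ "case_nat x e"])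

lemma upward_delta0: "delta0 \<phi> \<Longrightarrow> upward \<phi>"
  by (simp add: upward_def sat_delta0)

lemma upward_And: "upward \<phi> \<Longrightarrow> upward \<psi> \<Longrightarrow> upward (\<phi> \<^bold>\<and> \<psi>)"
  by (auto simp: upward_def eventually_conj_iff)

lemma upward_Or: "upward \<phi> \<Longrightarrow> upward \<psi> \<Longrightarrow> upward (\<phi> \<^bold>\<or> \<psi>)"
  by (auto simp: upward_def ev_disj)

lemma upward_Imp: "delta0 \<phi> \<Longrightarrow> upward \<psi> \<Longrightarrow> upward (\<phi> \<^bold>\<longrightarrow> \<psi>)"
  by (auto simp: upward_def ev_imp sat_delta0)

lemma upward_Ex:
  assumes "upward \<phi>"
  shows "upward (\<^bold>\<exists> \<phi>)"
proof (rule upwardI)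
  fix e assume "assignment e" "sat e (\<^bold>\<exists> \<phi>)"
  then obtain x where "x \<in> D" "sat (case_nat x e) \<phi>" by auto
  then have "\<forall>\<^sub>F n in U. holds (case_nat (x n) (coord e n)) \<phi>"
    using upward_case_nat[OF assms \<open>assignment e\<close>] by blast
  then show "\<forall>\<^sub>F n in U. holds (coord e n) (\<^bold>\<exists> \<phi>)"
    by (rule eventually_mono) auto
qed

lemma upward_ball:
  assumes "upward \<phi>"
  shows "upward (\<^bold>\<forall>\<^bold>\<le> t. \<phi>)"
proof (rule upwardI)
  fix e assume e: "assignment e" and sat: "sat e (\<^bold>\<forall>\<^bold>\<le> t. \<phi>)"
  have "\<forall>\<^sub>F n in U. holds (case_nat (x n) (coord e n)) \<phi>"
    if "x \<in> D" "\<forall>\<^sub>F n in U. x n \<le> val e t n" for x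
  proof -
    have "sat (case_nat x e) \<phi>"
      using sat that unfolding ball_def sat.simps val_lift val_Var_0 by blast
    then show ?thesis
      using upward_case_nat[OF assms e that(1)] by blast
  qed
  then show "\<forall>\<^sub>F n in U. holds (coord e n) (\<^bold>\<forall>\<^bold>\<le> t. \<phi>)"
    using ev_ball[OF val_in_D[OF e], of t "\<lambda>n x. holds (case_nat x (coord e n)) \<phi>"]
    by (simp add: val_def)
qed

lemma upward_goodstein_fm: "upward (goodstein_fm m i v)"
proof -
  note delta0_fms = beta_fm_def pair_fm_def mzero_fm_def mone_fm_def plus_fm_def times_fm_def
  note intros = upward_And upward_Or upward_Ex upward_ball upward_Imp
  have [intro!]: "delta0 (beta_fm a b c d)" "delta0 (pair_fm a b c)" "delta0 (mzero_fm a)"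
    "delta0 (mone_fm a)" "delta0 (plus_fm a b c)" "delta0 (times_fm a b)" for a b c d
    unfolding delta0_fms by (intro delta0.intros)+
  have mnum: "upward (mnum_fm a b)" for a b
    unfolding mnum_fm_def by (intro intros; (intro upward_delta0)?; (blast intro: delta0.intros)?)
  have nf: "upward (nf_fm a b c)" for a b c
    unfolding nf_fm_def
    by (intro intros mnum; (intro upward_delta0)?; (blast intro: delta0.intros)?)
  have mval: "upward (mval_fm a b c)" for a b c
    unfolding mval_fm_def
    by (intro intros; (intro upward_delta0)?; (blast intro: delta0.intros)?)
  show ?thesis
    unfolding goodstein_fm_def upgrade_fm_def
    by (intro intros nf mval; (intro upward_delta0)?; (blast intro: delta0.intros)?)
qed

text \<open>
  The only existential claims are those for predecessors and differences, and both are bounded by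
  given elements of the segment.
\<close>

lemma sat_robinson:
  assumes "\<phi> \<in> robinson"
  shows "sat e \<phi>"
proof -
  have pred: "\<exists>y\<in>D. \<forall>\<^sub>F n in U. x n = Suc (y n)" if "x \<in> D" "\<not> (\<forall>\<^sub>F n in U. x n = 0)" for x
  proof
    show "(\<lambda>n. x n - 1) \<in> D"
      using that(1) by (rule D_downward) simp
    show "\<forall>\<^sub>F n in U. x n = Suc (x n - 1)"
      using that(2)[folded ev_not] by eventually_elim simp
  qed
  have diff: "(\<forall>\<^sub>F n in U. x n \<le> y n) \<longleftrightarrow> (\<exists>z\<in>D. \<forall>\<^sub>F n in U. z n + x n = y n)"
    if "y \<in> D" for x y
  proof
    assume le: "\<forall>\<^sub>F n in U. x n \<le> y n"
    show "\<exists>z\<in>D. \<forall>\<^sub>F n in U. z n + x n = y n"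
    proof
      show "(\<lambda>n. y n - x n) \<in> D"
        using that by (rule D_downward) simp
      show "\<forall>\<^sub>F n in U. y n - x n + x n = y n"
        using le by eventually_elim simp
    qed
  next
    assume "\<exists>z\<in>D. \<forall>\<^sub>F n in U. z n + x n = y n"
    then show "\<forall>\<^sub>F n in U. x n \<le> y n"
      by (auto elim: eventually_mono)
  qed
  show ?thesis
    using assms pred diff nontrivial
    by (auto simp: robinson_def val_def numeral_2_eq_2)
qed

lemma sat_All_funpow:
  "(\<And>e. assignment e \<Longrightarrow> sat e \<phi>) \<Longrightarrow> assignment e \<Longrightarrow> sat e ((All ^^ n) \<phi>)"
  by (induction n arbitrary: e) auto

lemma list_encode_in_D:
  "(\<And>f. f \<in> set fs \<Longrightarrow> f \<in> D) \<Longrightarrow> (\<lambda>n. list_encode (map (\<lambda>f. f n) fs)) \<in> D"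
proof (induction fs)
  case (Cons f fs)
  let ?c = "\<lambda>n. list_encode (map (\<lambda>f. f n) fs)"
  have fc: "f \<in> D" "?c \<in> D"
    using Cons by auto
  have "prod_encode (a, b) \<le> (a + b) * Suc (a + b) + a" for a b
    by (simp add: prod_encode_def triangle_def)
  moreover have "(\<lambda>n. Suc ((f n + ?c n) * Suc (f n + ?c n) + f n)) \<in> D"
    using fc by (intro D_Suc D_add D_mult)
  ultimately show ?case
    by (auto intro: D_downward)
qed (simp add: D_zero)

end

lemma prod_encode_mono: "a \<le> a' \<Longrightarrow> prod_encode (a, b) \<le> prod_encode (a', b)"
  by (auto simp: prod_encode_def triangle_def intro!: add_mono div_le_mono mult_le_mono)

section \<open>Induction in semiregular cuts\<close>

text \<open>
  For every \<open>\<Sigma>\<^sub>1\<close> formula and every bound \<open>p\<close> on its parameters, a single element \<open>v\<close> of the segment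
  bounds witnesses for all those parameters that have witnesses in the segment at all. The parameter
  \<open>q\<close> ranges over all numbers up to \<open>p n\<close> in each copy of \<open>\<nat>\<close>.
\<close>

locale semiregular_cut = cut +
  assumes semiregular: "p \<in> D \<Longrightarrow> \<exists>v\<in>D. \<forall>w\<in>D. \<forall>\<^sub>F n in U. \<forall>q\<le>p n.
    bex_upto k \<theta> (w n) (env q) \<longrightarrow> bex_upto k \<theta> (v n) (env q)"
begin

text \<open>
  Suppose that induction for \<open>\<phi>\<close> fails at \<open>x\<close>. Semiregularity provides a bound \<open>v\<close> such that up to \<open>x\<close>
  the formula is equivalent to \<open>R\<close>, in which all quantifiers are bounded by \<open>v\<close>. Since \<open>R\<close> is a
  property of the single copies of \<open>\<nat>\<close>, the least counterexamples there form an element \<open>z\<close> of the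
  segment; the predecessor of \<open>z\<close> then refutes the induction step.
\<close>

lemma sat_induction_fm:
  assumes "sigma1 \<phi>" and below: "below (Suc N) \<phi>" and e: "assignment e"
  shows "sat e (induction_fm \<phi>)"
proof -
  obtain k \<theta> where \<theta>: "delta0 \<theta>" and \<phi>: "\<phi> = (Ex ^^ k) \<theta>"
    using sigma1_imp_Ex_delta0[OF assms(1)] by blast
  have "sat (case_nat x e) \<phi>"
    if zero: "sat (case_nat (\<lambda>n. 0) e) \<phi>"
      and Suc: "\<And>y. y \<in> D \<Longrightarrow> sat (case_nat y e) \<phi> \<Longrightarrow> sat (case_nat (\<lambda>n. Suc (y n)) e) \<phi>"
      and x: "x \<in> D" for x
  proof (rule ccontr)
    assume not: "\<not> sat (case_nat x e) \<phi>"
    \<comment> \<open>Codes are monotone in the induction variable, so the code of \<open>x\<close> bounds those of all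
      smaller arguments.\<close>
    define code where "code z n = list_encode (z # map (\<lambda>i. e i n) [0..<N])" for z n
    have code_mono: "z \<le> z' \<Longrightarrow> code z n \<le> code z' n" for z z' n
      by (simp add: code_def prod_encode_mono)
    have env: "bex_upto k \<theta> w (case_nat z (coord e n)) \<longleftrightarrow> bex_upto k \<theta> w (env (code z n))" for w z n
    proof (rule bex_upto_cong[of "Suc N"])
      show "below (Suc N) ((Ex ^^ k) \<theta>)"
        using below \<phi> by simp
      show "case_nat z (coord e n) i = env (code z n) i" if "i < Suc N" for i
        using that unfolding code_def
        by (subst env_list_encode) (auto simp: coord_def split: nat.split simp del: list_encode.simps)
    qed
    have "(\<lambda>n. code (x n) n) \<in> D"
      using list_encode_in_D[of "x # map e [0..<N]"] x e
      by (auto simp: code_def assignment_def comp_def)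
    then obtain v where v: "v \<in> D" and v_bound: "\<And>w. w \<in> D \<Longrightarrow> \<forall>\<^sub>F n in U. \<forall>q\<le>code (x n) n.
        bex_upto k \<theta> (w n) (env q) \<longrightarrow> bex_upto k \<theta> (v n) (env q)"
      using semiregular by blast
    define R where "R n z = bex_upto k \<theta> (v n) (case_nat z (coord e n))" for n z
    have sat_iff: "sat (case_nat z e) \<phi> \<longleftrightarrow> (\<forall>\<^sub>F n in U. R n (z n))"
      if z: "z \<in> D" "\<forall>\<^sub>F n in U. z n \<le> x n" for z
    proof
      assume "sat (case_nat z e) \<phi>"
      then obtain w where "w \<in> D" and w: "\<forall>\<^sub>F n in U. bex_upto k \<theta> (w n) (case_nat (z n) (coord e n))"
        using sat_Ex_funpow[OF \<theta>] z e by (auto simp: \<phi>)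
      show "\<forall>\<^sub>F n in U. R n (z n)"
        using w v_bound[OF \<open>w \<in> D\<close>] z(2)
        by eventually_elim (auto simp: R_def env code_mono)
    next
      assume "\<forall>\<^sub>F n in U. R n (z n)"
      then show "sat (case_nat z e) \<phi>"
        using sat_Ex_funpow[OF \<theta>] z e v by (auto simp: \<phi> R_def)
    qed
    have x_not: "\<forall>\<^sub>F n in U. \<not> R n (x n)"
      using not sat_iff[OF x] by (simp add: ev_not)
    define z where "z n = (LEAST z. \<not> R n z)" for n
    have z_le: "\<forall>\<^sub>F n in U. z n \<le> x n"
      using x_not by eventually_elim (simp add: z_def Least_le)
    have z_not: "\<forall>\<^sub>F n in U. \<not> R n (z n)"
      using x_not by eventually_elim (unfold z_def, rule LeastI)
    have "\<forall>\<^sub>F n in U. R n 0"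
      using zero sat_iff[OF D_zero] by simp
    then have z_pos: "\<forall>\<^sub>F n in U. 0 < z n"
      using z_not by eventually_elim (metis gr0I)
    have y: "(\<lambda>n. z n - 1) \<in> D" "\<forall>\<^sub>F n in U. z n - 1 \<le> x n"
      using z_le by (auto intro!: D_downward[OF x] elim: eventually_mono)
    have "\<forall>\<^sub>F n in U. R n (z n - 1)"
      using z_pos
    proof eventually_elim
      case (elim n)
      then show "R n (z n - 1)"
        using not_less_Least[of "z n - 1" "\<lambda>z. \<not> R n z"] unfolding z_def[symmetric] by simp
    qed
    then have "sat (case_nat (\<lambda>n. Suc (z n - 1)) e) \<phi>"
      using sat_iff[OF y] Suc[OF y(1)] by simp
    moreover have "\<forall>\<^sub>F n in U. Suc (z n - 1) \<le> x n"
      using z_le z_pos by eventually_elim simp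
    ultimately have "\<forall>\<^sub>F n in U. R n (Suc (z n - 1))"
      using sat_iff[OF D_Suc[OF y(1)]] by simp
    then have "\<forall>\<^sub>F n in U. False"
      using z_pos z_not by eventually_elim simp
    then show False
      using nontrivial by (simp add: trivial_limit_def)
  qed
  moreover have "(\<lambda>i. val (case_nat y e) ((Var(0 := Succ (Var 0))) i)) = case_nat (\<lambda>n. Suc (y n)) e" for y
    by (auto simp: fun_eq_iff val_def coord_def split: nat.split)
  moreover have "val e Zero = (\<lambda>n. 0)"
    by (simp add: val_def)
  ultimately show ?thesis
    unfolding induction_fm_def by (simp add: sat_subst sat_inst)
qed

theorem sat_ISigma1:
  assumes "\<phi> \<in> ISigma1" "assignment e"
  shows "sat e \<phi>"
  using assms(1) unfolding ISigma1_def
proof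
  assume "\<phi> \<in> robinson"
  then show ?thesis by (rule sat_robinson)
next
  assume "\<phi> \<in> {(All ^^ n) (induction_fm \<phi>) | n \<phi>. sigma1 \<phi> \<and> sentence ((All ^^ n) (induction_fm \<phi>))}"
  then obtain n \<psi> where \<phi>: "\<phi> = (All ^^ n) (induction_fm \<psi>)" and "sigma1 \<psi>"
    and "below n (induction_fm \<psi>)"
    by (auto simp: sentence_def below_All_funpow)
  then have "below (Suc n) \<psi>"
    by (simp add: induction_fm_def)
  then show ?thesis
    unfolding \<phi> using \<open>sigma1 \<psi>\<close> assms(2) by (intro sat_All_funpow sat_induction_fm)
qed

text \<open>
  The segment is a model of \<open>I\<Sigma>\<^sub>1\<close>, so values of functions that are provably total there stay inside
  the segment.
\<close>

lemma provable_totality_bounded: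
  assumes "ISigma1 \<turnstile> \<^bold>\<forall> \<^bold>\<exists> \<phi>" "upward \<phi>" "x \<in> D"
  shows "\<exists>y\<in>D. \<forall>\<^sub>F n in U. holds (case_nat (y n) (case_nat (x n) (\<lambda>i. 0))) \<phi>"
proof -
  let ?e = "\<lambda>i n. 0 :: nat"
  have e: "assignment ?e"
    by (simp add: assignment_def D_zero)
  have "sat ?e (\<^bold>\<forall> \<^bold>\<exists> \<phi>)"
    using soundness[OF assms(1) e] sat_ISigma1 e by blast
  then obtain y where "y \<in> D" "sat (case_nat y (case_nat x ?e)) \<phi>"
    using assms(3) by auto
  then have "\<forall>\<^sub>F n in U. holds (case_nat (y n) (coord (case_nat x ?e) n)) \<phi>"
    using assms(2,3) e by (intro upward_case_nat) auto
  with \<open>y \<in> D\<close> show ?thesis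
    by (auto simp: coord_def[of "\<lambda>i n. 0"])
qed

end

section \<open>Semiregular cuts from sequences with gaps\<close>

instance tm :: countable by countable_datatype
instance fm :: countable by countable_datatype

text \<open>
  An enumeration of all pairs of a number of quantifiers and a matrix, each pair being listed
  infinitely often: parameters that are bounded only late in a gap sequence must still be treated.
\<close>

definition nth_problem :: "nat \<Rightarrow> nat \<times> fm" where
  "nth_problem i = from_nat (fst (prod_decode i))"

lemma nth_problem_cofinal: "\<exists>i\<ge>j. nth_problem i = (k, \<theta>)"
  by (intro exI[of _ "prod_encode (to_nat (k, \<theta>), j)"])
    (simp add: nth_problem_def le_prod_encode_2)

definition bounded_truth :: "nat \<Rightarrow> nat \<Rightarrow> nat \<Rightarrow> bool" where
  "bounded_truth i w p = (case nth_problem i of (k, \<theta>) \<Rightarrow> bex_upto k \<theta> w (env p))"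

definition initial_segment :: "nat filter \<Rightarrow> (nat \<Rightarrow> nat \<Rightarrow> nat) \<Rightarrow> (nat \<Rightarrow> nat) set" where
  "initial_segment U b = {f. \<exists>i. \<forall>\<^sub>F n in U. f n \<le> b n i}"

text \<open>
  A parameter bound \<open>p\<close> lies below \<open>b i\<close> for some index \<open>i\<close> at which the given formula is treated.
  Witnesses in the segment lie below \<open>b n\<close> in almost every copy \<open>n\<close>, so the gap after stage \<open>i\<close> brings
  them below \<open>b (i + 1)\<close>, which belongs to the segment.
\<close>

lemma semiregular_initial_segment:
  assumes U: "U \<le> sequentially" "U \<noteq> bot"
    and ultra: "\<And>P. eventually P U \<or> eventually (\<lambda>n. \<not> P n) U"
    and b: "\<And>n. gap_sequence bounded_truth n (b n)"
  shows "semiregular_cut U (initial_segment U b)"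
proof -
  let ?D = "initial_segment U b"
  have large: "\<forall>\<^sub>F n in U. i < n" for i
    using U(1) eventually_gt_at_top[of i] by (auto simp: le_filter_def)
  have raise: "\<forall>\<^sub>F n in U. f n \<le> b n j" if "\<forall>\<^sub>F n in U. f n \<le> b n i" "i \<le> j" for f i j
    using that(1) large[of j]
    by eventually_elim (metis gap_sequence_mono[OF b] less_imp_le_nat order.trans that(2))
  have step: "\<forall>\<^sub>F n in U. (b n i + 1)\<^sup>2 \<le> b n (Suc i)" for i
    using large[of i] by eventually_elim (use b in \<open>auto simp: gap_sequence_def\<close>)
  have common: "\<exists>i. \<forall>\<^sub>F n in U. f n \<le> b n i \<and> g n \<le> b n i \<and> (b n i + 1)\<^sup>2 \<le> b n (Suc i)"
    if fg: "f \<in> ?D" "g \<in> ?D" for f g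
  proof -
    obtain i j where "\<forall>\<^sub>F n in U. f n \<le> b n i" "\<forall>\<^sub>F n in U. g n \<le> b n j"
      using fg by (auto simp: initial_segment_def)
    then have "\<forall>\<^sub>F n in U. f n \<le> b n (max i j)" "\<forall>\<^sub>F n in U. g n \<le> b n (max i j)"
      by (auto intro: raise)
    then show ?thesis
      using step[of "max i j"] by (auto simp: eventually_conj_iff)
  qed
  have closed: "(\<lambda>n. h (f n) (g n)) \<in> ?D"
    if fg: "f \<in> ?D" "g \<in> ?D" and h: "\<And>x y c. x \<le> c \<Longrightarrow> y \<le> c \<Longrightarrow> h x y \<le> (c + 1)\<^sup>2" for f g h
  proof -
    obtain i where "\<forall>\<^sub>F n in U. f n \<le> b n i \<and> g n \<le> b n i \<and> (b n i + 1)\<^sup>2 \<le> b n (Suc i)"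
      using common[OF fg] by blast
    then have "\<forall>\<^sub>F n in U. h (f n) (g n) \<le> b n (Suc i)"
      by eventually_elim (meson h order.trans)
    then show ?thesis
      by (auto simp: initial_segment_def)
  qed
  show ?thesis
  proof
    show "g \<in> ?D" if f: "f \<in> ?D" and g: "\<forall>\<^sub>F n in U. g n \<le> f n" for f g
    proof -
      obtain i where "\<forall>\<^sub>F n in U. f n \<le> b n i"
        using f by (auto simp: initial_segment_def)
      then have "\<forall>\<^sub>F n in U. g n \<le> b n i"
        using g by eventually_elim simp
      then show ?thesis by (auto simp: initial_segment_def)
    qed
    show "(\<lambda>n. 0) \<in> ?D"
      by (simp add: initial_segment_def)
    show "(\<lambda>n. Suc (f n)) \<in> ?D" if "f \<in> ?D" for f
      using that by (rule closed[of f f "\<lambda>x y. Suc x"]) (use that in \<open>auto simp: power2_eq_square\<close>)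
    show "(\<lambda>n. f n + g n) \<in> ?D" if "f \<in> ?D" "g \<in> ?D" for f g
      using that by (rule closed) (simp add: power2_eq_square)
    show "(\<lambda>n. f n * g n) \<in> ?D" if "f \<in> ?D" "g \<in> ?D" for f g
      using that
    proof (rule closed)
      show "x * y \<le> (c + 1)\<^sup>2" if "x \<le> c" "y \<le> c" for x y c :: nat
        using mult_le_mono[OF that] by (simp add: power2_eq_square)
    qed
  next
    fix p k \<theta> assume "p \<in> ?D"
    then obtain j where p: "\<forall>\<^sub>F n in U. p n \<le> b n j"
      by (auto simp: initial_segment_def)
    obtain i where "j \<le> i" and i: "nth_problem i = (k, \<theta>)"
      using nth_problem_cofinal by blast
    let ?v = "\<lambda>n. b n (Suc i)"
    have "\<forall>\<^sub>F n in U. \<forall>q\<le>p n. bex_upto k \<theta> (w n) (env q) \<longrightarrow> bex_upto k \<theta> (?v n) (env q)"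
      if w_in: "w \<in> ?D" for w
    proof -
      obtain l where w: "\<forall>\<^sub>F n in U. w n \<le> b n l"
        using w_in by (auto simp: initial_segment_def)
      show ?thesis
        using raise[OF p \<open>j \<le> i\<close>] w large[of i] large[of l]
      proof eventually_elim
        case (elim n)
        have "w n \<le> b n n"
          using elim gap_sequence_mono[OF b, of l n n] by simp
        moreover have "bex_upto k \<theta> (b n n) (env q) \<longrightarrow> bex_upto k \<theta> (?v n) (env q)" if "q \<le> p n" for q
          using b[of n] elim that i by (auto simp: gap_sequence_def bounded_truth_def)
        ultimately show ?case
          using bex_upto_mono by blast
      qed
    qed
    moreover have "?v \<in> ?D"
      by (auto simp: initial_segment_def intro!: exI[of _ "Suc i"])
    ultimately show "\<exists>v\<in>?D. \<forall>w\<in>?D. \<forall>\<^sub>F n in U. \<forall>q\<le>p n.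
        bex_upto k \<theta> (w n) (env q) \<longrightarrow> bex_upto k \<theta> (v n) (env q)"
      by (intro bexI[of _ ?v] ballI)
  qed (use U ultra in auto)
qed

text \<open>
  Relates the two ends: \<open>F\<^sub>2\<^sub>n\<^sub>+\<^sub>1(m)\<close> is the room needed for \<open>n\<close> gaps above \<open>m = 2\<^bsup>2n+5\<^esup>\<close>, and the Goodstein
  sequence that begins at \<open>m\<close> has length \<open>F\<^sub>2\<^sub>n\<^sub>+\<^sub>5(2) - 2\<close>.
\<close>

lemma fast_below_goodstein_length: "fast (2 * n + 1) (2 ^ (2 * n + 5)) + 2 < fast (2 * n + 5) 2"
proof -
  define x :: nat where "x = 2 ^ (2 * n + 5)"
  have x: "1 \<le> x"
    by (simp add: x_def)
  have "fast (2 * n + 1) x < fast (2 * n + 2) x" "fast (2 * n + 2) x < fast (2 * n + 3) x"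
    "fast (2 * n + 3) x < fast (2 * n + 4) x"
    by (rule fast_level_less[OF x], simp)+
  then have "fast (2 * n + 1) x + 2 < fast (2 * n + 4) x"
    by linarith
  also have "fast (2 * n + 4) x \<le> fast (2 * n + 5) 2"
  proof -
    have "fast (2 * n + 4) (2 ^ Suc (2 * n + 4)) \<le> fast (Suc (2 * n + 4)) 2"
      by (rule fast_two_power_le) simp
    moreover have "Suc (2 * n + 4) = 2 * n + 5"
      by simp
    ultimately show ?thesis
      unfolding x_def by (simp only:)
  qed
  finally show ?thesis
    unfolding x_def .
qed

theorem corollary7p13:
  shows "\<not> (ISigma1 \<turnstile> goodstein_terminates)"
proof
  assume provable: "ISigma1 \<turnstile> goodstein_terminates"
  let ?m = "\<lambda>n. 2 ^ (2 * n + 5) :: nat"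
  have "\<exists>\<beta>. \<beta> 0 = ?m n \<and> \<beta> n \<le> fast (2 * n + 1) (?m n) \<and> gap_sequence bounded_truth n \<beta>" for n
    by (intro gap_sequence_exists)
      (auto simp: bounded_truth_def intro: bex_upto_mono split: prod.splits)
  then obtain b where b: "\<And>n. b n 0 = ?m n" "\<And>n. b n n \<le> fast (2 * n + 1) (?m n)"
    "\<And>n. gap_sequence bounded_truth n (b n)"
    by metis
  obtain U :: "nat filter" where U: "U \<le> sequentially" "U \<noteq> bot"
    "\<And>P. eventually P U \<or> eventually (\<lambda>n. \<not> P n) U"
    using ultrafilter_exists[OF sequentially_bot] by blast
  interpret semiregular_cut U "initial_segment U b"
    using U b(3) by (rule semiregular_initial_segment)
  have "?m \<in> initial_segment U b"
    using b(1) by (auto simp: initial_segment_def intro!: exI[of _ 0])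
  from provable_totality_bounded[OF provable[unfolded goodstein_terminates_def] upward_goodstein_fm this]
  obtain y where "y \<in> initial_segment U b"
    and y: "\<forall>\<^sub>F n in U. holds (case_nat (y n) (case_nat (?m n) (\<lambda>i. 0))) (goodstein_fm (Var 1) (Var 0) Zero)"
    by blast
  then obtain i where i: "\<forall>\<^sub>F n in U. y n \<le> b n i"
    by (auto simp: initial_segment_def)
  have "\<forall>\<^sub>F n in U. i \<le> n"
    using U(1) eventually_ge_at_top[of i] by (auto simp: le_filter_def)
  with y i have "\<forall>\<^sub>F n in U. False"
  proof eventually_elim
    case (elim n)
    have "y n \<le> fast (2 * n + 1) (?m n)"
      using elim gap_sequence_mono[OF b(3), of i n n] b(2)[of n] by linarith
    then have "y n + 2 < fast (2 * n + 5) 2"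
      using fast_below_goodstein_length[of n] by linarith
    from goodstein_two_power_pos[OF this] elim(1) show False by (simp add: holds_goodstein_fm)
  qed
  with U(2) show False
    by (simp add: trivial_limit_def)
qed

end
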